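(* Let $K\subset\mathbb{R}^2$ be a compact convex set with boundary of class $C^2$ and support function $p$ of class $C^2$, and let $L$ be the length of $\partial K$. Let $c_k^2=a_k^2+b_k^2$, where $a_k,b_k$ are the Fourier coefficients of $p$. Let $m\ge 3$ be an integer. Then $$\int_{P\notin K}\sin^m\omega\,dP=\frac{\pi\, m!}{2^{m-1}(m-2)\,\Gamma\!\left(\frac{m+1}{2}\right)^2}\,\frac{L^2}{2\pi}+\frac{\pi^2\, m!}{2^{m-1}(m-2)}\sum_{k\ge 2,\ k\text{ even}}\frac{(-1)^{\frac k2+1}(k^2-1)}{\Gamma\!\left(\frac{m+1+k}{2}\right)\Gamma\!\left(\frac{m+1-k}{2}\right)}\,c_k^2,$$ where $\omega=\omega(P)$ is the visual angle of $K$ from $P$. For $m$ odd the index $k$ in the sum runs only over the even integers from $2$ to $m-1$.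
   Context: The support function of a compact convex set $K$ is the $2\pi$-periodic function $p(\varphi)=\sup\{x\cos\varphi+y\sin\varphi : (x,y)\in K\}$, with Fourier series $p(\varphi)=a_0+\sum_{n\ge1}(a_n\cos n\varphi+b_n\sin n\varphi)$. For $P\notin K$, the visual angle $\omega(P)\in(0,\pi)$ is the angle between the two tangent lines from $P$ to $\partial K$ (the angle at $P$ under which $K$ is seen). $dP$ denotes Lebesgue (area) measure on $\mathbb{R}^2$, and $\int_{P\notin K}$ is integration over $\mathbb{R}^2\setminus K$. $\Gamma$ is the Gamma function, and $1/\Gamma(x)=0$ when $x$ is a non-positive integer. *)

theory Defs
  imports "HOL-Analysis.Analysis"
begin

definition support_function :: "(real^2) set \<Rightarrow> real \<Rightarrow> real" where
  "support_function K \<phi> = (SUP P\<in>K. P $ 1 * cos \<phi> + P $ 2 * sin \<phi>)"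

text \<open>
  Coefficients of the real Fourier series
  \<open>a\<^sub>0 + (\<Sum>n\<ge>1. a\<^sub>n cos n\<phi> + b\<^sub>n sin n\<phi>)\<close> of a \<open>2\<pi>\<close>-periodic function; the constant
  term is \<open>a\<^sub>0\<close>, not \<open>a\<^sub>0 / 2\<close>.
\<close>

definition fourier_cos_coeff :: "(real \<Rightarrow> real) \<Rightarrow> nat \<Rightarrow> real" where
  "fourier_cos_coeff f n =
     (if n = 0 then 1 / (2 * pi) else 1 / pi) * integral {0..2 * pi} (\<lambda>\<phi>. f \<phi> * cos (real n * \<phi>))"

definition fourier_sin_coeff :: "(real \<Rightarrow> real) \<Rightarrow> nat \<Rightarrow> real" where
  "fourier_sin_coeff f n = 1 / pi * integral {0..2 * pi} (\<lambda>\<phi>. f \<phi> * sin (real n * \<phi>))"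

definition C2_function :: "(real \<Rightarrow> 'a::real_normed_vector) \<Rightarrow> bool" where
  "C2_function f \<longleftrightarrow>
     (\<exists>f'. (\<forall>t. (f has_vector_derivative f' t) (at t)) \<and> f' C1_differentiable_on UNIV)"

text \<open>
  The boundary of \<open>K\<close> is of class \<open>C\<^sup>2\<close>, as witnessed by a regular \<open>C\<^sup>2\<close> parametrization
  \<open>\<gamma>\<close> of \<open>frontier K\<close> as a simple closed curve. Periodicity on the whole line makes the
  curve \<open>C\<^sup>2\<close> at the closing point as well; points and segments are excluded.
\<close>

definition C2_boundary :: "(real^2) set \<Rightarrow> (real \<Rightarrow> real^2) \<Rightarrow> bool" where
  "C2_boundary K \<gamma> \<longleftrightarrow>
     C2_function \<gamma> \<and>
     (\<forall>t. vector_derivative \<gamma> (at t) \<noteq> 0) \<and>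
     (\<forall>t. \<gamma> (t + 1) = \<gamma> t) \<and>
     inj_on \<gamma> {0..<1} \<and>
     \<gamma> ` {0..<1} = frontier K"

definition curve_length :: "(real \<Rightarrow> real^2) \<Rightarrow> real" where
  "curve_length \<gamma> = integral {0..1} (\<lambda>t. norm (vector_derivative \<gamma> (at t)))"

text \<open>
  \<open>u\<close> is the unit direction from \<open>P\<close> to a point of tangency \<open>\<gamma> t\<close> of a tangent line
  of \<open>\<gamma>\<close> through \<open>P\<close>.
\<close>

definition tangent_direction :: "(real \<Rightarrow> real^2) \<Rightarrow> real^2 \<Rightarrow> real^2 \<Rightarrow> bool" where
  "tangent_direction \<gamma> P u \<longleftrightarrow>
     norm u = 1 \<and>
     (\<exists>t s c. 0 < s \<and> \<gamma> t = P + s *\<^sub>R u \<and> vector_derivative \<gamma> (at t) = c *\<^sub>R u)"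

text \<open>
  For \<open>\<gamma>\<close> the boundary of a compact convex set and \<open>P\<close> outside that set there are exactly
  two tangent directions, so the description is proper. The rays point towards the set, so
  this is the angle under which the set is seen, in \<open>(0, \<pi>)\<close>, rather than its supplement.
\<close>

definition visual_angle :: "(real \<Rightarrow> real^2) \<Rightarrow> real^2 \<Rightarrow> real" where
  "visual_angle \<gamma> P =
     (THE \<omega>. \<exists>u v. u \<noteq> v \<and> tangent_direction \<gamma> P u \<and> tangent_direction \<gamma> P v \<and>
        \<omega> = arccos (u \<bullet> v))"

end

theory Submission
  imports Defs
begin

text \<open>
  The theorem comes from describing a point \<open>P\<close> outside \<open>K\<close> by the two support lines of \<open>K\<close> through it.
  Let these lines have outer normals at angles \<open>\<phi>\<close> and \<open>\<phi> + \<theta>\<close> with \<open>0 < \<theta> < \<pi>\<close>. Every exterior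
  point arises from exactly one such pair with \<open>0 \<le> \<phi> < 2\<pi>\<close>, every such pair gives an exterior point,
  and \<open>K\<close> is seen from it under the angle \<open>\<omega> = \<pi> - \<theta>\<close> (\<open>notin_K_imp_meet\<close>, \<open>meet_inj\<close>,
  \<open>visual_angle_meet\<close>). There is no exceptional set: differentiability of \<open>p\<close> gives every
  support line a single point of contact, and regularity of \<open>\<gamma>\<close> gives every boundary point a single normal.
  Writing \<open>q = p(\<phi> + \<theta>)\<close> and \<open>q' = p'(\<phi> + \<theta>)\<close>, the tangent segments from \<open>P\<close> have lengths
  \<open>T\<^sub>1 = (q - p cos \<theta> - p' sin \<theta>) / sin \<theta>\<close> and \<open>T\<^sub>2 = (p - q cos \<theta> + q' sin \<theta>) / sin \<theta>\<close>, and
  \<open>dP = T\<^sub>1 T\<^sub>2 / sin \<theta> d\<phi> d\<theta>\<close>. Hence the integral of \<open>sin\<^sup>m \<omega>\<close> is the integral of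
  \<open>sin\<^sup>m\<^sup>-\<^sup>1 \<theta> T\<^sub>1 T\<^sub>2\<close> over \<open>0 \<le> \<phi> \<le> 2\<pi>\<close>, \<open>0 \<le> \<theta> \<le> \<pi>\<close> (\<open>visual_angle_integral\<close>).

  This integrand is quadratic in \<open>p\<close>. Integrating by parts in both variables, with boundary terms that
  vanish by periodicity in \<open>\<phi>\<close> and because \<open>m \<ge> 3\<close> in \<open>\<theta>\<close>, turns the integral into
  \<open>\<integral>\<^sub>0\<^sup>\<pi> G(\<theta>) R(\<theta>) d\<theta>\<close>, where \<open>R(\<theta>) = \<integral> p(\<phi>) p(\<phi> + \<theta>) d\<phi>\<close> is the autocorrelation of \<open>p\<close> and
  \<open>G = m / (m - 2) (D\<^sup>2 + 1) sin\<^sup>m\<^sup>-\<^sup>1\<close> (\<open>integral_tangent_product\<close>).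

  The cosine coefficients of \<open>R\<close> are, up to constants, the numbers \<open>c\<^sub>k\<^sup>2\<close>, so the Parseval identity for
  cosine series (\<open>parseval_cosine\<close>) expands this integral. The coefficients of \<open>G\<close> vanish for odd \<open>k\<close>
  by symmetry about \<open>\<pi>/2\<close>. For even \<open>k\<close> the operator \<open>D\<^sup>2 + 1\<close> contributes the factor \<open>1 - k\<^sup>2\<close>, and
  \<open>\<integral>\<^sub>0\<^sup>\<pi> sin\<^sup>n x cos kx dx\<close> is a product of two reciprocal Gamma values
  (\<open>integral_sin_power_mult_cos_even\<close>); for odd \<open>m\<close> and \<open>k > m\<close> one of them is taken at a
  non-positive integer, and so the series terminates. The term \<open>k = 0\<close> is the one with \<open>L\<^sup>2\<close>, by Cauchy's
  formula \<open>L = \<integral>\<^sub>0\<^sup>2\<^sup>\<pi> p\<close> (\<open>curve_length_eq\<close>).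
\<close>

section \<open>Cosine series on the interval from 0 to pi\<close>

text \<open>
  Since \<open>2 cos x cos kx = cos (k + 1)x + cos (k - 1)x\<close>, multiplication by \<open>cos x\<close> does not leave the space of
  functions all of whose cosine moments vanish.
\<close>

lemma cosine_moments_zero_imp_polynomial_moments_zero:
  fixes f :: "real \<Rightarrow> real"
  assumes f: "continuous_on {0..pi} f"
    and zero: "\<And>k::nat. integral {0..pi} (\<lambda>x. f x * cos (real k * x)) = 0"
  shows "integral {0..pi} (\<lambda>x. f x * cos x ^ j * cos (real k * x)) = 0"
proof (induction j arbitrary: k)
  case 0
  then show ?case using zero by simp
next
  case (Suc j)
  have int: "(\<lambda>x. f x * cos x ^ j * cos (real i * x)) integrable_on {0..pi}" for i
    by (intro integrable_continuous_interval continuous_intros f)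
  show ?case
  proof (cases k)
    case 0
    then show ?thesis using Suc.IH[of 1] by (simp add: mult_ac)
  next
    case (Suc i)
    have "f x * cos x ^ Suc j * cos (real k * x) =
        (f x * cos x ^ j * cos (real (i + 2) * x) + f x * cos x ^ j * cos (real i * x)) / 2" for x
    proof -
      have a: "cos (real (i + 2) * x) = cos (real k * x + x)" "cos (real i * x) = cos (real k * x - x)"
        by (simp_all add: Suc algebra_simps)
      show ?thesis unfolding a cos_add cos_diff by (simp add: algebra_simps)
    qed
    then have "integral {0..pi} (\<lambda>x. f x * cos x ^ Suc j * cos (real k * x)) =
        (integral {0..pi} (\<lambda>x. f x * cos x ^ j * cos (real (i + 2) * x)) +
         integral {0..pi} (\<lambda>x. f x * cos x ^ j * cos (real i * x))) / 2"
      by (simp only: integral_divide integral_add[OF int int])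
    then show ?thesis using Suc.IH by (simp only:) simp
  qed
qed

text \<open>
  Completeness of the cosines. Substituting \<open>x = arccos y\<close>, the Weierstrass theorem approximates \<open>f\<close> uniformly
  by polynomials in \<open>cos x\<close>; \<open>f\<close> is orthogonal to all of these, hence to itself.
\<close>

lemma continuous_cosine_moments_zero_imp_zero:
  fixes f :: "real \<Rightarrow> real"
  assumes f: "continuous_on {0..pi} f"
    and zero: "\<And>k::nat. integral {0..pi} (\<lambda>x. f x * cos (real k * x)) = 0"
    and x: "x \<in> {0..pi}"
  shows "f x = 0"
proof -
  have poly0: "integral {0..pi} (\<lambda>x. f x * P (cos x)) = 0" if "real_polynomial_function P" for P
  proof -
    from that obtain a n where P: "P = (\<lambda>x. \<Sum>i\<le>n. a i * x ^ i)"
      using real_polynomial_function_iff_sum by auto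
    have "integral {0..pi} (\<lambda>x. f x * P (cos x)) =
        integral {0..pi} (\<lambda>x. \<Sum>i\<le>n. a i * (f x * cos x ^ i * cos (real 0 * x)))"
      by (simp add: P sum_distrib_left mult_ac)
    also have "\<dots> = (\<Sum>i\<le>n. integral {0..pi} (\<lambda>x. a i * (f x * cos x ^ i * cos (real 0 * x))))"
      by (intro integral_sum integrable_continuous_interval continuous_intros f) auto
    also have "\<dots> = 0"
      using cosine_moments_zero_imp_polynomial_moments_zero[OF f zero, of _ 0]
      by (intro sum.neutral ballI) (simp only: integral_mult_right mult_zero_right)
    finally show ?thesis .
  qed
  have "bounded (f ` {0..pi})"
    using compact_continuous_image[OF f] compact_imp_bounded by blast
  then obtain M where M: "M > 0" "\<And>x. x \<in> {0..pi} \<Longrightarrow> \<bar>f x\<bar> \<le> M"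
    by (auto simp: bounded_pos)
  have small: "\<bar>integral {0..pi} (\<lambda>x. f x * f x)\<bar> \<le> e" if e: "e > 0" for e
  proof -
    let ?d = "e / (M * pi)"
    have "?d > 0" using e M by simp
    moreover have "continuous_on {-1..1} (\<lambda>y. f (arccos y))"
      using arccos_lbound arccos_ubound
      by (intro continuous_on_compose2[OF f] continuous_on_arccos' ) auto
    ultimately obtain P where P: "real_polynomial_function P"
        "\<And>y. y \<in> {-1..1} \<Longrightarrow> \<bar>f (arccos y) - P y\<bar> < ?d"
      using Stone_Weierstrass_real_polynomial_function[of "{-1..1}" "\<lambda>y. f (arccos y)" ?d] by auto
    have cP: "continuous_on {0..pi} (\<lambda>x. P (cos x))"
    proof (rule continuous_on_compose2[of UNIV P])
      show "continuous_on UNIV P"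
        using P(1) by (simp add: continuous_on_polymonial_function real_polynomial_function_eq)
    qed (intro continuous_intros, simp)
    have near: "\<bar>f x - P (cos x)\<bar> \<le> ?d" if "x \<in> {0..pi}" for x
    proof -
      have "arccos (cos x) = x" using that by (intro arccos_cos) auto
      moreover have "cos x \<in> {-1..1}" by simp
      ultimately show ?thesis using less_imp_le[OF P(2)[of "cos x"]] by (simp only:)
    qed
    have "integral {0..pi} (\<lambda>x. f x * f x) =
        integral {0..pi} (\<lambda>x. f x * f x) - integral {0..pi} (\<lambda>x. f x * P (cos x))"
      using poly0[OF P(1)] by simp
    also have "\<dots> = integral {0..pi} (\<lambda>x. f x * f x - f x * P (cos x))"
      by (rule integral_diff[symmetric]; intro integrable_continuous_interval continuous_intros f cP)
    also have "\<bar>\<dots>\<bar> \<le> (M * ?d) * (pi - 0)"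
    proof -
      have "norm (integral {0..pi} (\<lambda>x. f x * f x - f x * P (cos x))) \<le> (M * ?d) * (pi - 0)"
      proof (rule integral_bound)
        fix t assume t: "t \<in> {0..pi}"
        have "norm (f t * f t - f t * P (cos t)) = \<bar>f t\<bar> * \<bar>f t - P (cos t)\<bar>"
          by (simp add: abs_mult[symmetric] algebra_simps)
        also have "\<dots> \<le> M * ?d" using M t near[OF t] by (intro mult_mono) auto
        finally show "norm (f t * f t - f t * P (cos t)) \<le> M * ?d" .
      qed (auto intro!: continuous_intros f cP)
      then show ?thesis by simp
    qed
    also have "\<dots> = e" using M by (simp add: field_simps)
    finally show ?thesis .
  qed
  have "integral {0..pi} (\<lambda>x. f x * f x) = 0"
    using field_le_epsilon[of "\<bar>integral {0..pi} (\<lambda>x. f x * f x)\<bar>" 0] small by simp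
  moreover have "continuous_on {0..pi} (\<lambda>x. f x * f x)" by (intro continuous_intros f)
  ultimately have "f x * f x = 0"
    using integral_eq_0_iff[of 0 pi "\<lambda>x. f x * f x"] x by simp
  then show ?thesis by simp
qed

lemma integral_cos_int_multiple:
  "((\<lambda>x. cos (of_int n * x)) has_integral (if n = 0 then pi else 0)) {0..pi}"
proof (cases "n = 0")
  case True
  then show ?thesis using has_integral_const_real[of "1::real" 0 pi] by simp
next
  case False
  have "((\<lambda>x. cos (of_int n * x)) has_integral
      (sin (of_int n * pi) / of_int n - sin (of_int n * 0) / of_int n)) {0..pi}"
    using False
    by (intro fundamental_theorem_of_calculus)
       (auto intro!: derivative_eq_intros simp: has_real_derivative_iff_has_vector_derivative[symmetric])
  then show ?thesis using False by (simp add: sin_zero_iff_int2 mult.commute)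
qed

text \<open>
  The reciprocal of the squared norm of \<open>cos kx\<close> in \<open>L\<^sup>2(0, \<pi>)\<close>.
\<close>

definition cosine_weight :: "nat \<Rightarrow> real" where
  "cosine_weight k = (if k = 0 then 1 / pi else 2 / pi)"

lemma integral_cos_mult_cos:
  "integral {0..pi} (\<lambda>x. cos (real i * x) * cos (real j * x)) = (if i = j then 1 / cosine_weight j else 0)"
proof -
  have "cos (real i * x) * cos (real j * x) =
      (cos (of_int (int i - int j) * x) + cos (of_int (int i + int j) * x)) / 2" for x
    by (simp add: cos_times_cos algebra_simps)
  then have "((\<lambda>x. cos (real i * x) * cos (real j * x)) has_integral
     ((if int i - int j = 0 then pi else 0) + (if int i + int j = 0 then pi else 0)) / 2) {0..pi}"
    using has_integral_divide[OF has_integral_add[OF integral_cos_int_multiple integral_cos_int_multiple]]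
    by (simp only:)
  then have "integral {0..pi} (\<lambda>x. cos (real i * x) * cos (real j * x)) =
     ((if int i - int j = 0 then pi else 0) + (if int i + int j = 0 then pi else 0)) / 2"
    by (rule integral_unique)
  then show ?thesis by (auto simp: cosine_weight_def)
qed

lemma integral_cosine_series:
  fixes c :: "nat \<Rightarrow> real" and g :: "real \<Rightarrow> real"
  assumes c: "summable (\<lambda>k. \<bar>c k\<bar>)" and g: "continuous_on {0..pi} g"
  shows "continuous_on {0..pi} (\<lambda>x. \<Sum>k. c k * cos (real k * x))"
    and "(\<lambda>k. c k * integral {0..pi} (\<lambda>x. cos (real k * x) * g x)) sums
      integral {0..pi} (\<lambda>x. (\<Sum>k. c k * cos (real k * x)) * g x)"
proof -
  have bd: "norm (c k * cos (real k * x)) \<le> \<bar>c k\<bar>" for k x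
    by (simp add: abs_mult mult_left_le)
  have unif: "uniform_limit {0..pi} (\<lambda>n x. \<Sum>k<n. c k * cos (real k * x))
      (\<lambda>x. \<Sum>k. c k * cos (real k * x)) sequentially"
    by (rule Weierstrass_m_test[OF _ c]) (use bd in auto)
  show cont: "continuous_on {0..pi} (\<lambda>x. \<Sum>k. c k * cos (real k * x))"
    by (rule uniform_limit_theorem[OF _ unif]) (auto intro!: continuous_intros always_eventually)
  have "bounded (g ` {0..pi})" "bounded ((\<lambda>x. \<Sum>k. c k * cos (real k * x)) ` {0..pi})"
    using compact_continuous_image[OF g] compact_continuous_image[OF cont] compact_imp_bounded by blast+
  then have unif_g: "uniform_limit {0..pi} (\<lambda>n x. (\<Sum>k<n. c k * cos (real k * x)) * g x)
      (\<lambda>x. (\<Sum>k. c k * cos (real k * x)) * g x) sequentially"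
    by (intro uniform_lim_mult unif uniform_limit_const)
  obtain I J where
      I: "\<And>n. ((\<lambda>x. (\<Sum>k<n. c k * cos (real k * x)) * g x) has_integral I n) {0..pi}"
    and J: "((\<lambda>x. (\<Sum>k. c k * cos (real k * x)) * g x) has_integral J) {0..pi}"
    and lim: "I \<longlonglongrightarrow> J"
  proof (rule uniform_limit_integral[OF unif_g])
    show "continuous_on {0..pi} (\<lambda>x. (\<Sum>k<n. c k * cos (real k * x)) * g x)" for n
      by (intro continuous_intros g)
  qed (auto)
  have "I n = (\<Sum>k<n. c k * integral {0..pi} (\<lambda>x. cos (real k * x) * g x))" for n
  proof -
    have "I n = integral {0..pi} (\<lambda>x. \<Sum>k<n. c k * (cos (real k * x) * g x))"
      using integral_unique[OF I[of n]] by (simp add: sum_distrib_right mult.assoc)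
    also have "\<dots> = (\<Sum>k<n. integral {0..pi} (\<lambda>x. c k * (cos (real k * x) * g x)))"
      by (intro integral_sum integrable_continuous_interval continuous_intros g) auto
    finally show ?thesis by simp
  qed
  then have "I = (\<lambda>n. \<Sum>k<n. c k * integral {0..pi} (\<lambda>x. cos (real k * x) * g x))"
    by auto
  then show "(\<lambda>k. c k * integral {0..pi} (\<lambda>x. cos (real k * x) * g x)) sums
      integral {0..pi} (\<lambda>x. (\<Sum>k. c k * cos (real k * x)) * g x)"
    using lim integral_unique[OF J] by (simp only: sums_def)
qed

text \<open>
  The cosine series of \<open>f\<close> converges uniformly, its sum has the same cosine moments as \<open>f\<close>, and so the sum is
  \<open>f\<close> by completeness. Integration against \<open>g\<close> may then be done term by term.
\<close>

lemma parseval_cosine: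
  fixes f g :: "real \<Rightarrow> real"
  assumes f: "continuous_on {0..pi} f" and g: "continuous_on {0..pi} g"
    and r: "\<And>k::nat. r k = integral {0..pi} (\<lambda>x. f x * cos (real k * x))"
    and sm: "summable (\<lambda>k. \<bar>r k\<bar>)"
  shows "(\<lambda>k. cosine_weight k * r k * integral {0..pi} (\<lambda>x. cos (real k * x) * g x)) sums
      integral {0..pi} (\<lambda>x. f x * g x)"
proof -
  let ?c = "\<lambda>k. cosine_weight k * r k"
  let ?S = "\<lambda>x. \<Sum>k. ?c k * cos (real k * x)"
  have sc: "summable (\<lambda>k. \<bar>?c k\<bar>)"
  proof (rule summable_comparison_test'[of "\<lambda>k. 2 / pi * \<bar>r k\<bar>" 0])
    show "summable (\<lambda>k. 2 / pi * \<bar>r k\<bar>)" using sm by (rule summable_mult)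
    show "norm \<bar>?c k\<bar> \<le> 2 / pi * \<bar>r k\<bar>" for k
      by (auto simp: cosine_weight_def abs_mult intro!: mult_right_mono divide_right_mono)
  qed
  note S = integral_cosine_series[OF sc]
  have "f x - ?S x = 0" if "x \<in> {0..pi}" for x
  proof (rule continuous_cosine_moments_zero_imp_zero[OF _ _ that])
    show "continuous_on {0..pi} (\<lambda>x. f x - ?S x)"
      by (intro continuous_intros f S(1)[OF g])
    fix j :: nat
    have cj: "continuous_on {0..pi} (\<lambda>x. cos (real j * x))" by (intro continuous_intros)
    have "(\<lambda>k. ?c k * integral {0..pi} (\<lambda>x. cos (real k * x) * cos (real j * x))) =
        (\<lambda>k. if k = j then r j else 0)"
      by (auto simp: integral_cos_mult_cos cosine_weight_def)
    then have "(\<lambda>k. if k = j then r j else 0) sums integral {0..pi} (\<lambda>x. ?S x * cos (real j * x))"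
      using S(2)[OF cj] by simp
    then have "integral {0..pi} (\<lambda>x. ?S x * cos (real j * x)) = r j"
      using sums_single[of j "\<lambda>_. r j"] sums_unique2 by blast
    moreover have "integral {0..pi} (\<lambda>x. (f x - ?S x) * cos (real j * x)) =
        integral {0..pi} (\<lambda>x. f x * cos (real j * x)) - integral {0..pi} (\<lambda>x. ?S x * cos (real j * x))"
      unfolding left_diff_distrib
      by (intro integral_diff integrable_continuous_interval continuous_intros f S(1)[OF g])
    ultimately show "integral {0..pi} (\<lambda>x. (f x - ?S x) * cos (real j * x)) = 0"
      using r by simp
  qed
  then have "integral {0..pi} (\<lambda>x. ?S x * g x) = integral {0..pi} (\<lambda>x. f x * g x)"
    by (intro integral_cong) auto
  then show ?thesis using S(2)[OF g] by simp
qed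

section \<open>Fourier coefficients of powers of the sine\<close>

text \<open>
  This and the next lemma are the cases \<open>n = 0\<close> and \<open>n = 1\<close> of the Gamma factors below. Off \<open>j = 0\<close> one of the
  two arguments is a non-positive integer.
\<close>

lemma rGamma_mult_reflected_int:
  "rGamma (1 + of_int j) * rGamma (1 - of_int j :: real) = (if j = 0 then 1 else 0)"
proof (cases "j = 0")
  case False
  then consider "1 + j \<le> 0" | "1 - j \<le> 0" by linarith
  then have "of_int (1 + j) \<in> (\<int>\<^sub>\<le>\<^sub>0 :: real set) \<or> of_int (1 - j) \<in> (\<int>\<^sub>\<le>\<^sub>0 :: real set)"
    by cases (auto intro: nonpos_Ints_of_int simp del: of_int_add of_int_diff)
  then have "rGamma (1 + of_int j :: real) = 0 \<or> rGamma (1 - of_int j :: real) = 0"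
    unfolding rGamma_eq_zero_iff by simp
  then show ?thesis using False by auto
qed simp

text \<open>
  Both sides are multiplied by \<open>- (1 - 2j) / (3 + 2j)\<close> when \<open>j\<close> grows by one.
\<close>

lemma rGamma_mult_reflected_half_int:
  "pi * cos (pi * of_int j) * rGamma (3/2 + of_int j) * rGamma (3/2 - of_int j) = 4 / (1 - 4 * (of_int j)\<^sup>2)"
proof -
  have nat: "pi * cos (pi * real i) * rGamma (3/2 + real i) * rGamma (3/2 - real i) = 4 / (1 - 4 * (real i)\<^sup>2)" for i
  proof (induction i)
    case 0
    have "rGamma (3/2 :: real) = 2 / sqrt pi"
    proof -
      have "Gamma (3/2 :: real) = sqrt pi / 2"
        using rGamma_plus1[of "1/2::real"] Gamma_one_half_real
        by (simp add: rGamma_inverse_Gamma field_simps)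
      then show ?thesis unfolding rGamma_inverse_Gamma by (simp only:) simp
    qed
    then show ?case by simp
  next
    case (Suc i)
    let ?i = "real i"
    have a: "rGamma (3/2 + ?i) = (3/2 + ?i) * rGamma (3/2 + real (Suc i))"
      using rGamma_plus1[of "3/2 + ?i"] by (simp add: algebra_simps)
    have b: "rGamma (3/2 - real (Suc i)) = (1/2 - ?i) * rGamma (3/2 - ?i)"
      using rGamma_plus1[of "1/2 - ?i"] by (simp add: algebra_simps)
    have c: "cos (pi * real (Suc i)) = - cos (pi * ?i)" by (simp add: algebra_simps)
    let ?X = "pi * cos (pi * ?i) * rGamma (3/2 + real (Suc i)) * rGamma (3/2 - ?i)"
    have nz: "3/2 + ?i \<noteq> 0" "1 - 4 * ?i\<^sup>2 \<noteq> 0" "1 - 4 * (real (Suc i))\<^sup>2 \<noteq> 0"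
    proof -
      have *: "1 - 4 * (real_of_int l)\<^sup>2 \<noteq> 0" for l
      proof
        assume "1 - 4 * (real_of_int l)\<^sup>2 = 0"
        then have "real_of_int (4 * l\<^sup>2) = real_of_int 1" by simp
        then have "4 * l\<^sup>2 = 1" by (simp only: of_int_eq_iff)
        then show False by presburger
      qed
      show "1 - 4 * ?i\<^sup>2 \<noteq> 0" "1 - 4 * (real (Suc i))\<^sup>2 \<noteq> 0" using *[of "int i"] *[of "int (Suc i)"] by simp_all
    qed auto
    have "(3/2 + ?i) * ?X = 4 / (1 - 4 * ?i\<^sup>2)"
      using Suc.IH unfolding a by (simp only: mult_ac)
    then have "?X = 4 / (1 - 4 * ?i\<^sup>2) / (3/2 + ?i)" by (metis nonzero_mult_div_cancel_left nz(1))
    then have "- (1/2 - ?i) * ?X = - (1/2 - ?i) * (4 / (1 - 4 * ?i\<^sup>2) / (3/2 + ?i))" by simp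
    also have "\<dots> = 4 / (1 - 4 * (real (Suc i))\<^sup>2)"
    proof -
      have "1 - 4 * ?i\<^sup>2 = (1 - 2 * ?i) * (1 + 2 * ?i)" "1 - 4 * (real (Suc i))\<^sup>2 = - (1 + 2 * ?i) * (3 + 2 * ?i)"
        by (simp_all add: power2_eq_square algebra_simps)
      then show ?thesis using nz by (simp add: divide_simps) (simp add: algebra_simps)?
    qed
    finally show ?case unfolding b c by (simp only: mult_minus_left mult_minus_right mult_ac)
  qed
  show ?thesis
  proof (cases j)
    case (nonneg n)
    then show ?thesis using nat[of n] by simp
  next
    case (neg n)
    then have "of_int j = - real (Suc n)" by simp
    then show ?thesis using nat[of "Suc n"] by (simp only: mult_minus_right cos_minus power2_minus) (simp add: mult_ac)
  qed
qed

text \<open>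
  Induction in steps of two. By \<open>sin\<^sup>2 x = (1 - cos 2x) / 2\<close> the integral for \<open>n + 2\<close> and \<open>j\<close> is a combination of
  those for \<open>n\<close> and \<open>j - 1\<close>, \<open>j\<close>, \<open>j + 1\<close>. With \<open>a = n/2 + 1 + j\<close> and \<open>b = n/2 + 1 - j\<close>, the recurrence of the
  reciprocal Gamma function reduces the claim to
  \<open>ab/2 + b(b - 1)/4 + a(a - 1)/4 = (a + b)(a + b - 1)/4\<close>, where \<open>a + b = n + 2\<close>. Integer \<open>j\<close> keeps \<open>j - 1\<close>
  available throughout.
\<close>

lemma integral_sin_power_mult_cos_even:
  "integral {0..pi} (\<lambda>x. sin x ^ n * cos (2 * of_int j * x)) =
    pi * cos (pi * of_int j) * fact n / 2 ^ n *
    (rGamma (real n / 2 + 1 + of_int j) * rGamma (real n / 2 + 1 - of_int j))"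
proof (induction n arbitrary: j rule: nat_induct2)
  case 0
  then show ?case
    using integral_unique[OF integral_cos_int_multiple[of "2 * j"]] rGamma_mult_reflected_int[of j]
    by (auto simp: mult.assoc)
next
  case 1
  have odd: "1 + 2 * j \<noteq> 0" "1 - 2 * j \<noteq> 0" by presburger+
  then have nz: "1 + 2 * real_of_int j \<noteq> 0" "1 - 2 * real_of_int j \<noteq> 0" by linarith+
  have e: "cos ((1 + 2 * real_of_int j) * pi) = -1" "cos ((1 - 2 * real_of_int j) * pi) = -1"
  proof -
    have "cos (pi + 2 * pi * of_int j) = -1" "cos (pi - 2 * pi * of_int j) = -1"
      unfolding cos_add cos_diff by simp_all
    then show "cos ((1 + 2 * real_of_int j) * pi) = -1" "cos ((1 - 2 * real_of_int j) * pi) = -1"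
      by (simp_all add: algebra_simps)
  qed
  let ?F = "\<lambda>x. - cos ((1 + 2 * real_of_int j) * x) / (2 * (1 + 2 * real_of_int j))
      - cos ((1 - 2 * real_of_int j) * x) / (2 * (1 - 2 * real_of_int j))"
  have "((\<lambda>x. sin x * cos (2 * of_int j * x)) has_integral (?F pi - ?F 0)) {0..pi}"
  proof (rule fundamental_theorem_of_calculus)
    fix x :: real
    have *: "sin x * cos (2 * of_int j * x) =
       (sin ((1 + 2 * real_of_int j) * x) + sin ((1 - 2 * real_of_int j) * x)) / 2"
      by (simp add: sin_times_cos algebra_simps)
    show "(?F has_vector_derivative sin x * cos (2 * of_int j * x)) (at x within {0..pi})"
      unfolding * has_real_derivative_iff_has_vector_derivative[symmetric]
      using nz by (auto intro!: derivative_eq_intros simp: divide_simps) (simp add: algebra_simps)?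
  qed simp
  then have "integral {0..pi} (\<lambda>x. sin x * cos (2 * of_int j * x)) = ?F pi - ?F 0"
    by (rule integral_unique)
  also have "\<dots> = 2 / (1 - 4 * (of_int j)\<^sup>2)"
  proof -
    have "1 - 4 * (real_of_int j)\<^sup>2 = (1 + 2 * real_of_int j) * (1 - 2 * real_of_int j)"
      by (simp add: power2_eq_square algebra_simps)
    then show ?thesis unfolding e using nz by (simp add: divide_simps) (simp add: algebra_simps)
  qed
  also have "\<dots> = (pi * cos (pi * of_int j) * rGamma (3/2 + of_int j) * rGamma (3/2 - of_int j)) / 2"
  proof -
    have "2 / D = (4 / D) / 2" for D :: real by simp
    then show ?thesis unfolding rGamma_mult_reflected_half_int .
  qed
  finally show ?case by (simp add: mult_ac)
next
  case (step n)
  let ?r = "\<lambda>x. rGamma x :: real"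
  have int: "(\<lambda>x. sin x ^ n * cos (2 * of_int i * x)) integrable_on {0..pi}" for i :: int
    by (intro integrable_continuous_interval continuous_intros)
  have pt: "sin x ^ (n + 2) * cos (2 * of_int j * x) = sin x ^ n * cos (2 * of_int j * x) / 2
      - (sin x ^ n * cos (2 * of_int (j + 1) * x) + sin x ^ n * cos (2 * of_int (j - 1) * x)) / 4" for x :: real
  proof -
    have "cos (2 * of_int (j + 1) * x) + cos (2 * of_int (j - 1) * x) = 2 * cos (2 * of_int j * x) * cos (2 * x)"
      by (simp add: cos_add cos_diff algebra_simps)
    moreover have "cos (2 * x) = 1 - 2 * (sin x)\<^sup>2" by (simp add: cos_double_sin)
    ultimately have "cos (2 * of_int (j + 1) * x) + cos (2 * of_int (j - 1) * x) = 2 * cos (2 * of_int j * x) * (1 - 2 * (sin x)\<^sup>2)"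
      by simp
    then have "sin x ^ n * cos (2 * of_int (j + 1) * x) + sin x ^ n * cos (2 * of_int (j - 1) * x)
       = sin x ^ n * (2 * cos (2 * of_int j * x) * (1 - 2 * (sin x)\<^sup>2))"
      by (simp only: distrib_left[symmetric])
    moreover have "sin x ^ (n + 2) * cos (2 * of_int j * x) = sin x ^ n * cos (2 * of_int j * x) / 2
        - sin x ^ n * (2 * cos (2 * of_int j * x) * (1 - 2 * (sin x)\<^sup>2)) / 4"
    proof -
      have "S * s\<^sup>2 * C = S * C / 2 - S * (2 * C * (1 - 2 * s\<^sup>2)) / 4" for S C s :: real
        by (simp add: field_simps)
      then show ?thesis unfolding power_add .
    qed
    ultimately show ?thesis by (simp only:)
  qed
  define a b :: real where "a = real n / 2 + 1 + of_int j" and "b = real n / 2 + 1 - of_int j"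
  have ra: "?r (a - 1) = (a - 1) * (a * ?r (a + 1))" "?r a = a * ?r (a + 1)"
    using rGamma_plus1[of "a - 1"] rGamma_plus1[of a] by simp_all
  have rb: "?r (b - 1) = (b - 1) * (b * ?r (b + 1))" "?r b = b * ?r (b + 1)"
    using rGamma_plus1[of "b - 1"] rGamma_plus1[of b] by simp_all
  have cs: "cos (pi * of_int (j + 1)) = - cos (pi * of_int j)" "cos (pi * of_int (j - 1)) = - cos (pi * of_int j)"
    by (simp_all add: algebra_simps cos_add cos_diff)
  have n: "a + b = real n + 2" by (simp add: a_def b_def)
  let ?C = "pi * cos (pi * of_int j) * fact n / 2 ^ n"
  have "integral {0..pi} (\<lambda>x. sin x ^ (n + 2) * cos (2 * of_int j * x)) =
      integral {0..pi} (\<lambda>x. sin x ^ n * cos (2 * of_int j * x)) / 2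
      - (integral {0..pi} (\<lambda>x. sin x ^ n * cos (2 * of_int (j + 1) * x))
       + integral {0..pi} (\<lambda>x. sin x ^ n * cos (2 * of_int (j - 1) * x))) / 4"
    unfolding pt
    by (subst integral_diff integral_add integral_divide; (intro integrable_diff integrable_add integrable_on_divide int)?)+ simp
  also have "\<dots> = ?C * (?r a * ?r b / 2 + (?r (a + 1) * ?r (b - 1) + ?r (a - 1) * ?r (b + 1)) / 4)"
  proof -
    have i0: "integral {0..pi} (\<lambda>x. sin x ^ n * cos (2 * of_int j * x)) = ?C * (?r a * ?r b)"
      unfolding step.IH a_def b_def ..
    have ab: "real n / 2 + 1 + of_int (j + 1) = a + 1" "real n / 2 + 1 - of_int (j + 1) = b - 1"
        "real n / 2 + 1 + of_int (j - 1) = a - 1" "real n / 2 + 1 - of_int (j - 1) = b + 1"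
      by (simp_all add: a_def b_def)
    have i1: "integral {0..pi} (\<lambda>x. sin x ^ n * cos (2 * of_int (j + 1) * x)) = - ?C * (?r (a + 1) * ?r (b - 1))"
      unfolding step.IH cs ab by simp
    have i2: "integral {0..pi} (\<lambda>x. sin x ^ n * cos (2 * of_int (j - 1) * x)) = - ?C * (?r (a - 1) * ?r (b + 1))"
      unfolding step.IH cs ab by simp
    have "C * X / 2 - (- C * Y + - C * Z) / 4 = C * (X / 2 + (Y + Z) / 4)" for C X Y Z :: real
      by (simp add: field_simps)
    then show ?thesis unfolding i0 i1 i2 .
  qed
  also have "\<dots> = ?C * (?r (a + 1) * ?r (b + 1) * ((a + b) * (a + b - 1) / 4))"
    unfolding ra rb by (simp add: field_simps)
  also have "\<dots> = pi * cos (pi * of_int j) * fact (n + 2) / 2 ^ (n + 2) * (?r (a + 1) * ?r (b + 1))"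
    unfolding n by (simp add: field_simps)
  moreover have "real (n + 2) / 2 + 1 + of_int j = a + 1" "real (n + 2) / 2 + 1 - of_int j = b + 1"
    by (simp_all add: a_def b_def field_simps)
  ultimately show ?case by (simp only:)
qed

section \<open>The integration kernel and the autocorrelation of a periodic function\<close>

lemma integral_reflect_interval:
  fixes f :: "real \<Rightarrow> real"
  assumes "continuous_on {a..b} f"
  shows "integral {a..b} (\<lambda>x. f (a + b - x)) = integral {a..b} f"
proof (cases "a \<le> b")
  case True
  have "(f has_integral integral {a..b} f) (cbox a b)"
    using integrable_integral[OF integrable_continuous_interval[OF assms]] by simp
  from has_integral_affinity[OF this, of "-1" "a + b"]
  have "((\<lambda>x. f (a + b - x)) has_integral integral {a..b} f) ((\<lambda>x. (a + b) - x) ` {a..b})"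
    by (simp add: add.commute)
  moreover have "(\<lambda>x. (a + b) - x) ` {a..b} = {a..b}"
    using image_diff_atLeastAtMost[of "a+b" a b] by simp
  ultimately show ?thesis by (metis integral_unique)
qed simp

lemma integral_periodic_shift:
  fixes f :: "real \<Rightarrow> real"
  assumes cont: "continuous_on UNIV f" and per: "\<And>x. f (x + T) = f x" and a: "0 \<le> a" "a \<le> T"
  shows "integral {0..T} (\<lambda>x. f (x + a)) = integral {0..T} f"
proof -
  have int: "f integrable_on {x..y}" for x y
    using cont by (intro integrable_continuous_interval) (rule continuous_on_subset, auto)
  have sh: "integral {x..y} (\<lambda>t. f (t + c)) = integral {x + c..y + c} f" for x y c
    using integral_shift[of x c y f] continuous_on_subset[OF cont, of "{x + c..y + c}"]
    by (simp add: o_def)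
  have "integral {0..T} (\<lambda>x. f (x + a)) = integral {a..T + a} f" using sh[of 0 T a] by simp
  also have "\<dots> = integral {a..T} f + integral {T..T + a} f"
    using a by (simp add: Henstock_Kurzweil_Integration.integral_combine[OF _ _ int])
  also have "integral {T..T + a} f = integral {0..a} f"
    using sh[of 0 a T] per by (simp add: add.commute)
  also have "integral {a..T} f + integral {0..a} f = integral {0..T} f"
    using Henstock_Kurzweil_Integration.integral_combine[of 0 a T f] a int by simp
  finally show ?thesis .
qed

text \<open>
  For \<open>m = n + 3\<close> this is \<open>m / (m - 2) (D\<^sup>2 + 1)\<close> applied to \<open>sin\<^sup>m\<^sup>-\<^sup>1\<close>.
\<close>

definition sine_kernel :: "nat \<Rightarrow> real \<Rightarrow> real" where
  "sine_kernel n x = (real n + 3) * (real n + 2) * sin x ^ n - (real n + 3)\<^sup>2 * sin x ^ (n + 2)"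

lemma continuous_on_sine_kernel [continuous_intros]: "continuous_on S (sine_kernel n)"
  unfolding sine_kernel_def by (intro continuous_intros)

lemma sine_kernel_cos_coeff_odd:
  assumes "odd k"
  shows "integral {0..pi} (\<lambda>x. cos (real k * x) * sine_kernel n x) = 0"
proof -
  let ?f = "\<lambda>x. cos (real k * x) * sine_kernel n x"
  have "cos (real k * (pi - x)) = - cos (real k * x)" for x
  proof -
    have "cos (real k * pi) = -1" "sin (real k * pi) = 0"
      using assms by (simp_all add: cos_npi)
    then show ?thesis by (simp add: right_diff_distrib cos_diff)
  qed
  then have "?f (0 + pi - x) = - ?f x" for x
    by (simp add: sine_kernel_def)
  then have "integral {0..pi} ?f = - integral {0..pi} ?f"
    using integral_reflect_interval[of 0 pi ?f] by (simp add: continuous_intros)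
  then show ?thesis by simp
qed

text \<open>
  The factor \<open>1 - k\<^sup>2\<close> is the symbol of \<open>D\<^sup>2 + 1\<close>. Here it comes from
  \<open>(n + 2)(n + 1) J(n) = ((n + 2)\<^sup>2 - k\<^sup>2) J(n + 2)\<close> for \<open>J(n) = \<integral>\<^sub>0\<^sup>\<pi> sin\<^sup>n x cos kx dx\<close>, which is the
  recurrence of the Gamma factors.
\<close>

lemma sine_kernel_cos_coeff_even:
  "integral {0..pi} (\<lambda>x. cos (real (2 * i) * x) * sine_kernel n x) =
    (real n + 3) * (1 - (real (2 * i))\<^sup>2) / (real n + 1) * (pi * (-1) ^ i * fact (n + 2) / 2 ^ (n + 2) *
     (rGamma (real n / 2 + 2 + real i) * rGamma (real n / 2 + 2 - real i)))"
proof -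
  define a b :: real where "a = real n / 2 + 1 + real i" and "b = real n / 2 + 1 - real i"
  define J where "J k = integral {0..pi} (\<lambda>x. sin x ^ k * cos (2 * of_int (int i) * x))" for k
  \<comment> \<open>A name keeps the Gamma product atomic for the arithmetic below.\<close>
  define P :: real where "P = pi * (-1) ^ i * fact (n + 2) / 2 ^ (n + 2) * (rGamma (a + 1) * rGamma (b + 1))"
  have c: "cos (pi * of_int (int i)) = (-1) ^ i" by (simp add: cos_npi2)
  have J2: "J (n + 2) = P"
  proof -
    have "real (n + 2) / 2 + 1 + real_of_int (int i) = a + 1" "real (n + 2) / 2 + 1 - real_of_int (int i) = b + 1"
      by (simp_all add: a_def b_def field_simps)
    then show ?thesis unfolding J_def P_def integral_sin_power_mult_cos_even c by (simp only:)
  qed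
  have "J n = pi * (-1) ^ i * fact n / 2 ^ n * (rGamma a * rGamma b)"
    unfolding J_def integral_sin_power_mult_cos_even c by (simp add: a_def b_def)
  moreover have "rGamma a = a * rGamma (a + 1)" "rGamma b = b * rGamma (b + 1)"
    by (simp_all add: rGamma_plus1)
  ultimately have "J n = a * b * (pi * (-1) ^ i * fact n / 2 ^ n * (rGamma (a + 1) * rGamma (b + 1)))"
    by (simp only:) simp
  moreover have "4 * P = (real n + 2) * (real n + 1) * (pi * (-1) ^ i * fact n / 2 ^ n * (rGamma (a + 1) * rGamma (b + 1)))"
  proof -
    have "(fact (n + 2) :: real) = (real n + 2) * (real n + 1) * fact n" by (simp add: algebra_simps)
    then show ?thesis unfolding P_def by (simp only: power_add) simp
  qed
  moreover have "N * X = 4 * (a * b) * P" if "X = a * b * Q" "4 * P = N * Q" for N X P Q :: real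
  proof -
    have "4 * (a * b) * P = a * b * (4 * P)" by simp
    also have "\<dots> = N * X" unfolding that by simp
    finally show ?thesis ..
  qed
  ultimately have "(real n + 2) * (real n + 1) * J n = 4 * (a * b) * P" by blast
  also have "4 * (a * b) = (real n + 2)\<^sup>2 - (real (2 * i))\<^sup>2"
    by (simp add: a_def b_def power2_eq_square algebra_simps)
  finally have J0: "(real n + 2) * J n = ((real n + 2)\<^sup>2 - (real (2 * i))\<^sup>2) * P / (real n + 1)"
    by (simp add: field_simps)
  have "integral {0..pi} (\<lambda>x. cos (real (2 * i) * x) * sine_kernel n x) =
     integral {0..pi} (\<lambda>x. (real n + 3) * (real n + 2) * (sin x ^ n * cos (2 * of_int (int i) * x))
       - (real n + 3)\<^sup>2 * (sin x ^ (n + 2) * cos (2 * of_int (int i) * x)))"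
    by (simp add: sine_kernel_def algebra_simps)
  also have "\<dots> = (real n + 3) * ((real n + 2) * J n) - (real n + 3)\<^sup>2 * J (n + 2)"
    unfolding J_def
    by (subst integral_diff) (auto intro!: integrable_continuous_interval continuous_intros)
  also have "\<dots> = (real n + 3) * (1 - (real (2 * i))\<^sup>2) / (real n + 1) * P"
    unfolding J0 J2 by (simp add: field_simps) (simp add: power2_eq_square algebra_simps)?
  moreover have "a + 1 = real n / 2 + 2 + real i" "b + 1 = real n / 2 + 2 - real i"
    by (simp_all add: a_def b_def)
  ultimately show ?thesis unfolding P_def by (simp only:)
qed

text \<open>
  The functions \<open>dp\<close> and \<open>ddp\<close> stand for \<open>p'\<close> and \<open>p''\<close>.
\<close>

locale C2_periodic =
  fixes p dp ddp :: "real \<Rightarrow> real"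
  assumes p_deriv: "\<And>x. (p has_real_derivative dp x) (at x)"
    and dp_deriv: "\<And>x. (dp has_real_derivative ddp x) (at x)"
    and ddp_cont: "continuous_on UNIV ddp"
    and p_periodic: "\<And>x. p (x + 2 * pi) = p x"
begin

lemma dp_periodic: "dp (x + 2 * pi) = dp x"
proof -
  have "((\<lambda>x. p (x + 2 * pi)) has_real_derivative dp (x + 2 * pi)) (at x)"
    using DERIV_shift[of p "dp (x + 2 * pi)" x "2 * pi"] p_deriv by simp
  then show ?thesis unfolding p_periodic by (rule DERIV_unique) (rule p_deriv)
qed

lemma p_cont: "continuous_on UNIV p" and dp_cont: "continuous_on UNIV dp"
  by (auto intro!: continuous_at_imp_continuous_on DERIV_isCont p_deriv dp_deriv)

lemma cont_compose [continuous_intros]: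
  fixes f :: "'a::topological_space \<Rightarrow> real"
  assumes "continuous_on S f"
  shows "continuous_on S (\<lambda>x. p (f x))" "continuous_on S (\<lambda>x. dp (f x))" "continuous_on S (\<lambda>x. ddp (f x))"
  using assms continuous_on_compose2[OF p_cont] continuous_on_compose2[OF dp_cont]
    continuous_on_compose2[OF ddp_cont] by auto

definition autocorr :: "real \<Rightarrow> real" where
  "autocorr \<theta> = integral {0..2*pi} (\<lambda>\<phi>. p \<phi> * p (\<phi> + \<theta>))"

lemma continuous_on_autocorr: "continuous_on {a..b} autocorr"
proof -
  have "continuous_on {a..b} (\<lambda>\<theta>. integral (cbox 0 (2*pi)) (\<lambda>\<phi>. p \<phi> * p (\<phi> + \<theta>)))"
    by (intro integral_continuous_on_param) (auto simp: split_def intro!: continuous_intros)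
  then show ?thesis unfolding autocorr_def[abs_def] by simp
qed

lemma autocorr_reflect:
  assumes "0 \<le> \<theta>" "\<theta> \<le> 2 * pi"
  shows "autocorr (2 * pi - \<theta>) = autocorr \<theta>"
proof -
  let ?f = "\<lambda>\<psi>. p \<psi> * p (\<psi> - \<theta>)"
  have shift: "p (x + 2 * pi - \<theta>) = p (x - \<theta>)" for x
    using p_periodic[of "x - \<theta>"] by (simp add: algebra_simps)
  have "integral {0..2*pi} (\<lambda>\<phi>. ?f (\<phi> + \<theta>)) = integral {0..2*pi} ?f"
    using assms by (intro integral_periodic_shift) (auto intro!: continuous_intros simp: p_periodic shift)
  moreover have "autocorr (2 * pi - \<theta>) = integral {0..2*pi} ?f"
    unfolding autocorr_def using shift by (simp add: algebra_simps)
  ultimately show ?thesis by (simp add: autocorr_def mult.commute)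
qed

text \<open>
  By Fubini and periodicity, the cosine coefficients of the autocorrelation are the squared absolute values of
  the Fourier coefficients of \<open>p\<close>. The factor 1/2 passes from a full period to half of it, as the
  autocorrelation is symmetric about \<open>\<pi>\<close>.
\<close>

lemma integral_autocorr_cos:
  fixes k :: nat
  defines "A \<equiv> integral {0..2*pi} (\<lambda>\<phi>. p \<phi> * cos (real k * \<phi>))"
    and "B \<equiv> integral {0..2*pi} (\<lambda>\<phi>. p \<phi> * sin (real k * \<phi>))"
  shows "integral {0..pi} (\<lambda>\<theta>. autocorr \<theta> * cos (real k * \<theta>)) = (A\<^sup>2 + B\<^sup>2) / 2"
proof -
  let ?h = "\<lambda>\<theta>. autocorr \<theta> * cos (real k * \<theta>)"
  have per: "cos (real k * (x + 2 * pi) - y) = cos (real k * x - y)" for x y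
  proof -
    have "cos (real k * (x + 2 * pi) - y) = cos ((real k * x - y) + real k * (2 * pi))"
      by (simp add: algebra_simps)
    also have "\<dots> = cos (real k * x - y)"
      using sin_npi[of "2 * k"] cos_npi[of "2 * k"] by (simp add: cos_add mult_ac)
    finally show ?thesis .
  qed
  have inner: "integral {0..2*pi} (\<lambda>\<theta>. p (\<phi> + \<theta>) * cos (real k * \<theta>)) = A * cos (real k * \<phi>) + B * sin (real k * \<phi>)"
    if "\<phi> \<in> {0..2*pi}" for \<phi>
  proof -
    let ?f = "\<lambda>\<psi>. p \<psi> * cos (real k * \<psi> - real k * \<phi>)"
    have "integral {0..2*pi} (\<lambda>\<theta>. p (\<phi> + \<theta>) * cos (real k * \<theta>)) = integral {0..2*pi} (\<lambda>\<theta>. ?f (\<theta> + \<phi>))"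
      by (simp add: algebra_simps)
    also have "\<dots> = integral {0..2*pi} ?f"
      using that by (intro integral_periodic_shift) (auto intro!: continuous_intros simp: p_periodic per)
    also have "\<dots> = integral {0..2*pi} (\<lambda>\<psi>. p \<psi> * cos (real k * \<psi>) * cos (real k * \<phi>) + p \<psi> * sin (real k * \<psi>) * sin (real k * \<phi>))"
      by (simp add: cos_diff algebra_simps)
    also have "\<dots> = A * cos (real k * \<phi>) + B * sin (real k * \<phi>)"
      unfolding A_def B_def
      by (subst integral_add) (auto intro!: integrable_continuous_interval continuous_intros)
    finally show ?thesis .
  qed
  have "integral {0..2*pi} ?h = integral (cbox 0 (2*pi)) (\<lambda>\<theta>. integral (cbox 0 (2*pi)) (\<lambda>\<phi>. p \<phi> * p (\<phi> + \<theta>) * cos (real k * \<theta>)))"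
    by (simp add: autocorr_def)
  also have "\<dots> = integral (cbox 0 (2*pi)) (\<lambda>\<phi>. integral (cbox 0 (2*pi)) (\<lambda>\<theta>. p \<phi> * p (\<phi> + \<theta>) * cos (real k * \<theta>)))"
    by (rule integral_swap_continuous) (auto simp: split_def intro!: continuous_intros)
  also have "\<dots> = integral {0..2*pi} (\<lambda>\<phi>. p \<phi> * integral {0..2*pi} (\<lambda>\<theta>. p (\<phi> + \<theta>) * cos (real k * \<theta>)))"
    by (simp add: mult.assoc)
  also have "\<dots> = integral {0..2*pi} (\<lambda>\<phi>. A * (p \<phi> * cos (real k * \<phi>)) + B * (p \<phi> * sin (real k * \<phi>)))"
  proof (intro integral_cong)
    fix \<phi> :: real assume "\<phi> \<in> {0..2*pi}"
    then show "p \<phi> * integral {0..2*pi} (\<lambda>\<theta>. p (\<phi> + \<theta>) * cos (real k * \<theta>)) =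
        A * (p \<phi> * cos (real k * \<phi>)) + B * (p \<phi> * sin (real k * \<phi>))"
      by (simp only: inner) (simp add: algebra_simps)
  qed
  also have "\<dots> = A * A + B * B"
    by (subst integral_add) (auto simp: A_def B_def intro!: integrable_continuous_interval continuous_intros)
  finally have full: "integral {0..2*pi} ?h = A * A + B * B" .
  have hc: "continuous_on {x..y} ?h" for x y by (intro continuous_intros continuous_on_autocorr)
  have "integral {0..2*pi} ?h = integral {0..pi} ?h + integral {pi..2*pi} ?h"
    by (intro Henstock_Kurzweil_Integration.integral_combine[symmetric] integrable_continuous_interval hc) auto
  also have "integral {pi..2*pi} ?h = integral {0..pi} (\<lambda>\<theta>. ?h (\<theta> + pi))"
    using integral_shift[of 0 pi pi ?h] hc[of pi "2*pi"] by (simp add: o_def)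
  also have "\<dots> = integral {0..pi} (\<lambda>\<theta>. ?h ((0 + pi - \<theta>) + pi))"
    by (rule integral_reflect_interval[symmetric])
       (rule continuous_on_compose2[OF hc[of 0 "2*pi"]], auto intro!: continuous_intros)
  also have "\<dots> = integral {0..pi} ?h"
  proof (intro integral_cong)
    fix \<theta> assume t: "\<theta> \<in> {0..pi}"
    have "cos (real k * (2 * pi - \<theta>)) = cos (real k * \<theta>)"
      using per[of "-\<theta>" 0] by (simp add: algebra_simps)
    moreover have "(0 + pi - \<theta>) + pi = 2 * pi - \<theta>" by simp
    ultimately show "?h ((0 + pi - \<theta>) + pi) = ?h \<theta>"
      using autocorr_reflect[of \<theta>] t by (simp only:) auto
  qed
  finally show ?thesis using full by (simp add: power2_eq_square)
qed

end

section \<open>Reduction of the double integral to the autocorrelation\<close>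

context C2_periodic
begin

text \<open>
  The product \<open>T\<^sub>1 T\<^sub>2 sin\<^sup>2 \<theta>\<close> of the two tangent lengths.
\<close>

definition tangent_product :: "real \<Rightarrow> real \<Rightarrow> real" where
  "tangent_product \<phi> \<theta> =
    (p (\<phi> + \<theta>) - p \<phi> * cos \<theta> - dp \<phi> * sin \<theta>) *
    (p \<phi> - p (\<phi> + \<theta>) * cos \<theta> + dp (\<phi> + \<theta>) * sin \<theta>)"

text \<open>
  The two flux functions are the primitives, in \<open>\<theta>\<close> and in \<open>\<phi>\<close>, that remove all derivatives of \<open>p\<close> from
  \<open>sin\<^sup>n \<theta> T\<^sub>1 T\<^sub>2 sin\<^sup>2 \<theta>\<close>. First \<open>p'q\<close>, \<open>p'q'\<close>, \<open>qq'\<close> and \<open>pp'\<close> are traded for \<open>pq'\<close> and \<open>pq''\<close> by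
  \<open>\<phi>\<close>-derivatives; then \<open>pq'\<close> and \<open>pq''\<close>, which are \<open>\<theta>\<close>-derivatives of \<open>pq\<close> and \<open>pq'\<close>, are integrated by
  parts in \<open>\<theta>\<close>.
\<close>

definition theta_flux :: "nat \<Rightarrow> real \<Rightarrow> real \<Rightarrow> real" where
  "theta_flux n \<phi> \<theta> = sin \<theta> ^ (n + 2) * (p \<phi> * dp (\<phi> + \<theta>))
     - (real n + 4) * (sin \<theta> ^ (n + 1) * cos \<theta> * (p \<phi> * p (\<phi> + \<theta>)))"

definition theta_flux_deriv :: "nat \<Rightarrow> real \<Rightarrow> real \<Rightarrow> real" where
  "theta_flux_deriv n \<phi> \<theta> =
     (real n + 2) * sin \<theta> ^ (n + 1) * cos \<theta> * (p \<phi> * dp (\<phi> + \<theta>))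
     + sin \<theta> ^ (n + 2) * (p \<phi> * ddp (\<phi> + \<theta>))
     - (real n + 4) * ((real n + 1) * sin \<theta> ^ n * cos \<theta> * cos \<theta> - sin \<theta> ^ (n + 2)) * (p \<phi> * p (\<phi> + \<theta>))
     - (real n + 4) * (sin \<theta> ^ (n + 1) * cos \<theta> * (p \<phi> * dp (\<phi> + \<theta>)))"

definition phi_flux :: "nat \<Rightarrow> real \<Rightarrow> real \<Rightarrow> real" where
  "phi_flux n \<phi> \<theta> = sin \<theta> ^ (n + 1) * (p (\<phi> + \<theta>) * p (\<phi> + \<theta>) - p \<phi> * p \<phi>) / 2
     + sin \<theta> ^ (n + 1) * cos \<theta> * (p \<phi> * p (\<phi> + \<theta>)) - sin \<theta> ^ (n + 2) * (p \<phi> * dp (\<phi> + \<theta>))"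

definition phi_flux_deriv :: "nat \<Rightarrow> real \<Rightarrow> real \<Rightarrow> real" where
  "phi_flux_deriv n \<phi> \<theta> = sin \<theta> ^ (n + 1) * (p (\<phi> + \<theta>) * dp (\<phi> + \<theta>) - p \<phi> * dp \<phi>)
     + sin \<theta> ^ (n + 1) * cos \<theta> * (dp \<phi> * p (\<phi> + \<theta>) + p \<phi> * dp (\<phi> + \<theta>))
     - sin \<theta> ^ (n + 2) * (dp \<phi> * dp (\<phi> + \<theta>) + p \<phi> * ddp (\<phi> + \<theta>))"

lemma DERIV_compose [derivative_intros]:
  assumes "(f has_real_derivative f') (at x within S)"
  shows "((\<lambda>x. p (f x)) has_real_derivative dp (f x) * f') (at x within S)"
    and "((\<lambda>x. dp (f x)) has_real_derivative ddp (f x) * f') (at x within S)"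
  using assms DERIV_chain2[OF p_deriv] DERIV_chain2[OF dp_deriv] by blast+

lemma theta_flux_has_deriv:
  "(theta_flux n \<phi> has_real_derivative theta_flux_deriv n \<phi> \<theta>) (at \<theta> within S)"
  unfolding theta_flux_def[abs_def] theta_flux_deriv_def
  by (rule derivative_eq_intros refl | simp)+ (simp add: algebra_simps)

lemma phi_flux_has_deriv:
  "((\<lambda>\<phi>. phi_flux n \<phi> \<theta>) has_real_derivative phi_flux_deriv n \<phi> \<theta>) (at \<phi> within S)"
  unfolding phi_flux_def phi_flux_deriv_def
  by (rule derivative_eq_intros refl | simp)+ (simp add: field_simps)

text \<open>
  Every term of the flux carries a positive power of \<open>sin \<theta>\<close>, so the flux vanishes at both ends.
\<close>

lemma integral_theta_flux_deriv: "integral {0..pi} (theta_flux_deriv n \<phi>) = 0"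
proof -
  have "(theta_flux_deriv n \<phi> has_integral theta_flux n \<phi> pi - theta_flux n \<phi> 0) {0..pi}"
    using theta_flux_has_deriv
    by (intro fundamental_theorem_of_calculus) (auto simp: has_real_derivative_iff_has_vector_derivative[symmetric])
  then show ?thesis by (simp add: integral_unique theta_flux_def)
qed

lemma integral_phi_flux_deriv: "integral {0..2*pi} (\<lambda>\<phi>. phi_flux_deriv n \<phi> \<theta>) = 0"
proof -
  have "((\<lambda>\<phi>. phi_flux_deriv n \<phi> \<theta>) has_integral phi_flux n (2*pi) \<theta> - phi_flux n 0 \<theta>) {0..2*pi}"
    using phi_flux_has_deriv
    by (intro fundamental_theorem_of_calculus) (auto simp: has_real_derivative_iff_has_vector_derivative[symmetric])
  moreover have "p (2 * pi + \<theta>) = p \<theta>" "dp (2 * pi + \<theta>) = dp \<theta>" "p (2 * pi) = p 0"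
    using p_periodic[of \<theta>] dp_periodic[of \<theta>] p_periodic[of 0] by (simp_all add: add.commute)
  ultimately show ?thesis by (simp add: integral_unique phi_flux_def)
qed

text \<open>
  The second summand on the right integrates to zero, because its \<open>\<phi>\<close>-integral is a constant multiple of
  \<open>sin\<^sup>n \<theta> cos \<theta>\<close>.
\<close>

lemma tangent_product_decomposition:
  "sin \<theta> ^ n * tangent_product \<phi> \<theta> =
     sine_kernel n \<theta> * (p \<phi> * p (\<phi> + \<theta>)) - sin \<theta> ^ n * cos \<theta> * (p \<phi> * p \<phi> + p (\<phi> + \<theta>) * p (\<phi> + \<theta>))
     + theta_flux_deriv n \<phi> \<theta> + phi_flux_deriv n \<phi> \<theta>"
proof -
  have c2: "cos \<theta> * cos \<theta> = 1 - sin \<theta> * sin \<theta>"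
    using sin_cos_squared_add[of \<theta>] by (simp add: power2_eq_square algebra_simps)
  define S s c where "S = sin \<theta> ^ n" and "s = sin \<theta>" and "c = cos \<theta>"
  have cc: "c * c = 1 - s * s" "c * (c * x) = x - s * (s * x)" for x
    using c2 by (simp_all add: s_def c_def mult.assoc[symmetric] left_diff_distrib)
  have pow: "sin \<theta> ^ (n + 1) = S * s" "sin \<theta> ^ (n + 2) = S * s * s"
    by (simp_all add: S_def s_def power_add power2_eq_square)
  show ?thesis
    unfolding tangent_product_def sine_kernel_def theta_flux_deriv_def phi_flux_deriv_def pow
      S_def[symmetric] s_def[symmetric] c_def[symmetric]
    by (simp add: algebra_simps cc power2_eq_square)
qed

lemma integral_tangent_product:
  "integral {0..pi} (\<lambda>\<theta>. integral {0..2*pi} (\<lambda>\<phi>. sin \<theta> ^ n * tangent_product \<phi> \<theta>)) =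
   integral {0..pi} (\<lambda>\<theta>. autocorr \<theta> * sine_kernel n \<theta>)"
proof -
  define E where "E = integral {0..2*pi} (\<lambda>\<phi>. p \<phi> * p \<phi>)"
  let ?H = "\<lambda>\<theta>. integral {0..2*pi} (\<lambda>\<phi>. theta_flux_deriv n \<phi> \<theta>)"
  have contH: "continuous_on (cbox (0, 0) (pi, 2*pi)) (\<lambda>(\<theta>, \<phi>). theta_flux_deriv n \<phi> \<theta>)"
    unfolding split_def theta_flux_deriv_def by (intro continuous_intros)
  have "continuous_on {0..pi} (\<lambda>\<theta>. integral (cbox 0 (2*pi)) (\<lambda>\<phi>. theta_flux_deriv n \<phi> \<theta>))"
    by (intro integral_continuous_on_param) (auto simp: split_def theta_flux_deriv_def intro!: continuous_intros)
  then have intH: "?H integrable_on {0..pi}" by (intro integrable_continuous_interval) simp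
  have H0: "integral {0..pi} ?H = 0"
  proof -
    have "integral {0..pi} ?H = integral {0..2*pi} (\<lambda>\<phi>. integral {0..pi} (\<lambda>\<theta>. theta_flux_deriv n \<phi> \<theta>))"
      using integral_swap_continuous[OF contH] by simp
    then show ?thesis by (simp add: integral_theta_flux_deriv)
  qed
  have inner: "integral {0..2*pi} (\<lambda>\<phi>. sin \<theta> ^ n * tangent_product \<phi> \<theta>) =
      autocorr \<theta> * sine_kernel n \<theta> - 2 * E * (sin \<theta> ^ n * cos \<theta>) + ?H \<theta>" if "\<theta> \<in> {0..pi}" for \<theta>
  proof -
    have E2: "integral {0..2*pi} (\<lambda>\<phi>. p (\<phi> + \<theta>) * p (\<phi> + \<theta>)) = E"
      unfolding E_def using that
      by (intro integral_periodic_shift[of "\<lambda>x. p x * p x"]) (auto intro!: continuous_intros simp: p_periodic)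
    note int = integrable_continuous_interval
    have i1: "(\<lambda>\<phi>. sine_kernel n \<theta> * (p \<phi> * p (\<phi> + \<theta>))) integrable_on {0..2*pi}"
      by (intro int continuous_intros)
    have i2: "(\<lambda>\<phi>. sin \<theta> ^ n * cos \<theta> * (p \<phi> * p \<phi> + p (\<phi> + \<theta>) * p (\<phi> + \<theta>))) integrable_on {0..2*pi}"
      by (intro int continuous_intros)
    have i3: "(\<lambda>\<phi>. theta_flux_deriv n \<phi> \<theta>) integrable_on {0..2*pi}"
      unfolding theta_flux_deriv_def by (intro int continuous_intros)
    have i4: "(\<lambda>\<phi>. phi_flux_deriv n \<phi> \<theta>) integrable_on {0..2*pi}"
      unfolding phi_flux_deriv_def by (intro int continuous_intros)
    have sq: "integral {0..2*pi} (\<lambda>\<phi>. p \<phi> * p \<phi> + p (\<phi> + \<theta>) * p (\<phi> + \<theta>)) = 2 * E"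
      using E2 by (subst integral_add) (auto simp: E_def intro!: int continuous_intros)
    show ?thesis
      unfolding tangent_product_decomposition
      using i1 i2 i3 i4
      by (simp add: integral_add integral_diff integrable_add integrable_diff integral_phi_flux_deriv sq
          flip: autocorr_def)
  qed
  have sc: "integral {0..pi} (\<lambda>\<theta>. sin \<theta> ^ n * cos \<theta>) = 0"
  proof -
    have "((\<lambda>\<theta>. sin \<theta> ^ n * cos \<theta>) has_integral (sin pi ^ (n + 1) / (real n + 1) - sin 0 ^ (n + 1) / (real n + 1))) {0..pi}"
    proof (rule fundamental_theorem_of_calculus)
      fix x :: real
      have "((\<lambda>x. sin x ^ (n + 1) / (real n + 1)) has_real_derivative sin x ^ n * cos x) (at x within {0..pi})"
        by (rule derivative_eq_intros refl | simp)+ (simp add: field_simps)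
      then show "((\<lambda>x. sin x ^ (n + 1) / (real n + 1)) has_vector_derivative sin x ^ n * cos x) (at x within {0..pi})"
        by (simp add: has_real_derivative_iff_has_vector_derivative)
    qed simp
    then show ?thesis by (simp add: integral_unique)
  qed
  have "integral {0..pi} (\<lambda>\<theta>. integral {0..2*pi} (\<lambda>\<phi>. sin \<theta> ^ n * tangent_product \<phi> \<theta>)) =
     integral {0..pi} (\<lambda>\<theta>. autocorr \<theta> * sine_kernel n \<theta> - 2 * E * (sin \<theta> ^ n * cos \<theta>) + ?H \<theta>)"
    by (intro integral_cong inner)
  also have "\<dots> = integral {0..pi} (\<lambda>\<theta>. autocorr \<theta> * sine_kernel n \<theta> - 2 * E * (sin \<theta> ^ n * cos \<theta>)) + integral {0..pi} ?H"
    by (intro integral_add intH integrable_continuous_interval continuous_intros continuous_on_autocorr)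
  also have "\<dots> = integral {0..pi} (\<lambda>\<theta>. autocorr \<theta> * sine_kernel n \<theta>)"
    unfolding H0
    by (subst integral_diff) (auto simp: sc intro!: integrable_continuous_interval continuous_intros continuous_on_autocorr)
  finally show ?thesis .
qed

end

section \<open>The Fourier expansion of the double integral\<close>

context C2_periodic
begin

definition fourier_power :: "nat \<Rightarrow> real" where
  "fourier_power k = (fourier_cos_coeff p k)\<^sup>2 + (fourier_sin_coeff p k)\<^sup>2"

lemma integral_autocorr_cos_fourier:
  "integral {0..pi} (\<lambda>\<theta>. autocorr \<theta> * cos (real k * \<theta>)) =
    (if k = 0 then 2 * pi\<^sup>2 else pi\<^sup>2 / 2) * fourier_power k"
  unfolding integral_autocorr_cos fourier_power_def fourier_cos_coeff_def fourier_sin_coeff_def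
  by (simp add: field_simps power2_eq_square)

text \<open>
  One integration by parts. The decay \<open>1/k\<close> is enough, because only squares of the coefficients are summed.
\<close>

lemma fourier_integral_bound:
  obtains M where "M \<ge> 0"
    "\<And>k::nat. k > 0 \<Longrightarrow> \<bar>integral {0..2*pi} (\<lambda>\<phi>. p \<phi> * cos (real k * \<phi>))\<bar> \<le> M / real k"
    "\<And>k::nat. k > 0 \<Longrightarrow> \<bar>integral {0..2*pi} (\<lambda>\<phi>. p \<phi> * sin (real k * \<phi>))\<bar> \<le> M / real k"
proof -
  have "compact (dp ` {0..2*pi})"
    by (intro compact_continuous_image continuous_on_subset[OF dp_cont]) auto
  then obtain D where D: "D > 0" "\<And>x. x \<in> {0..2*pi} \<Longrightarrow> \<bar>dp x\<bar> \<le> D"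
    using compact_imp_bounded by (force simp: bounded_pos)
  have bound: "\<bar>integral {0..2*pi} (\<lambda>\<phi>. p \<phi> * t \<phi>)\<bar> \<le> D * (2 * pi) / real k"
    if k: "k > 0" and T: "\<And>x. (T has_real_derivative real k * t x) (at x)" "T (2*pi) = T 0"
      and T1: "\<And>x. \<bar>T x\<bar> \<le> 1" and ct: "continuous_on {0..2*pi} t" for k :: nat and t T
  proof -
    have cT: "continuous_on {0..2*pi} T"
      using T(1) by (meson DERIV_isCont continuous_at_imp_continuous_on)
    have "((\<lambda>\<phi>. dp \<phi> * T \<phi> + real k * (p \<phi> * t \<phi>)) has_integral p (2*pi) * T (2*pi) - p 0 * T 0) {0..2*pi}"
    proof (rule fundamental_theorem_of_calculus)
      fix x :: real
      show "((\<lambda>x. p x * T x) has_vector_derivative dp x * T x + real k * (p x * t x)) (at x within {0..2*pi})"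
        unfolding has_real_derivative_iff_has_vector_derivative[symmetric]
        by (rule derivative_eq_intros p_deriv[THEN DERIV_subset] T(1)[THEN DERIV_subset] refl subset_UNIV)+ (simp add: algebra_simps)
    qed simp
    moreover have "p (2*pi) = p 0" using p_periodic[of 0] by simp
    ultimately have "integral {0..2*pi} (\<lambda>\<phi>. dp \<phi> * T \<phi> + real k * (p \<phi> * t \<phi>)) = 0"
      using T(2) by (simp add: integral_unique)
    moreover have "integral {0..2*pi} (\<lambda>\<phi>. dp \<phi> * T \<phi> + real k * (p \<phi> * t \<phi>)) =
        integral {0..2*pi} (\<lambda>\<phi>. dp \<phi> * T \<phi>) + real k * integral {0..2*pi} (\<lambda>\<phi>. p \<phi> * t \<phi>)"
      by (subst integral_add) (auto intro!: integrable_continuous_interval continuous_intros cT ct)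
    ultimately have eq: "real k * integral {0..2*pi} (\<lambda>\<phi>. p \<phi> * t \<phi>) = - integral {0..2*pi} (\<lambda>\<phi>. dp \<phi> * T \<phi>)"
      by linarith
    have "norm (integral {0..2*pi} (\<lambda>\<phi>. dp \<phi> * T \<phi>)) \<le> D * (2 * pi - 0)"
    proof (rule integral_bound)
      fix x assume "x \<in> {0..2*pi}"
      then have "\<bar>dp x\<bar> * \<bar>T x\<bar> \<le> D * 1" using D T1 by (intro mult_mono) auto
      then show "norm (dp x * T x) \<le> D" by (simp add: abs_mult)
    qed (auto intro!: continuous_intros cT)
    then have "real k * \<bar>integral {0..2*pi} (\<lambda>\<phi>. p \<phi> * t \<phi>)\<bar> \<le> D * (2 * pi)"
      using eq by (metis abs_minus_cancel abs_mult abs_of_nat diff_zero real_norm_def)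
    then show ?thesis using k by (simp add: field_simps)
  qed
  show thesis
  proof
    show "0 \<le> D * (2 * pi)" using D by simp
    fix k :: nat assume k: "k > 0"
    have per: "sin (real k * (2 * pi)) = 0" "cos (real k * (2 * pi)) = 1"
      using sin_npi[of "2 * k"] cos_npi[of "2 * k"] by (simp_all add: mult_ac)
    show "\<bar>integral {0..2*pi} (\<lambda>\<phi>. p \<phi> * cos (real k * \<phi>))\<bar> \<le> D * (2 * pi) / real k"
      by (rule bound[OF k, of "\<lambda>x. sin (real k * x)"])
         (auto intro!: derivative_eq_intros continuous_intros simp: per)
    show "\<bar>integral {0..2*pi} (\<lambda>\<phi>. p \<phi> * sin (real k * \<phi>))\<bar> \<le> D * (2 * pi) / real k"
      by (rule bound[OF k, of "\<lambda>x. - cos (real k * x)"])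
         (auto intro!: derivative_eq_intros continuous_intros simp: per)
  qed
qed

lemma summable_integral_autocorr_cos:
  "summable (\<lambda>k. \<bar>integral {0..pi} (\<lambda>\<theta>. autocorr \<theta> * cos (real k * \<theta>))\<bar>)"
proof -
  obtain M where M: "M \<ge> 0"
    "\<And>k::nat. k > 0 \<Longrightarrow> \<bar>integral {0..2*pi} (\<lambda>\<phi>. p \<phi> * cos (real k * \<phi>))\<bar> \<le> M / real k"
    "\<And>k::nat. k > 0 \<Longrightarrow> \<bar>integral {0..2*pi} (\<lambda>\<phi>. p \<phi> * sin (real k * \<phi>))\<bar> \<le> M / real k"
    by (rule fourier_integral_bound) (rule that)
  show ?thesis
  proof (rule summable_comparison_test'[of "\<lambda>k. M\<^sup>2 * inverse (real k ^ 2)" 1])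
    show "summable (\<lambda>k. M\<^sup>2 * inverse (real k ^ 2))"
      by (intro summable_mult inverse_power_summable) simp
    fix k :: nat assume k: "k \<ge> 1"
    let ?A = "integral {0..2*pi} (\<lambda>\<phi>. p \<phi> * cos (real k * \<phi>))"
    let ?B = "integral {0..2*pi} (\<lambda>\<phi>. p \<phi> * sin (real k * \<phi>))"
    have "0 < k" "\<bar>M / real k\<bar> = M / real k" using k M(1) by auto
    then have "\<bar>?A\<bar> \<le> \<bar>M / real k\<bar>" "\<bar>?B\<bar> \<le> \<bar>M / real k\<bar>"
      using M(2,3)[of k] by metis+
    then have "?A\<^sup>2 \<le> (M / real k)\<^sup>2" "?B\<^sup>2 \<le> (M / real k)\<^sup>2"
      unfolding abs_le_square_iff .
    moreover have "(M / real k)\<^sup>2 = M\<^sup>2 * inverse (real k ^ 2)"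
      by (simp only: divide_inverse power_mult_distrib power_inverse)
    moreover have "(a + b) / 2 \<le> X" if "a \<le> Y" "b \<le> Y" "Y = X" for a b X Y :: real
      using that by simp
    ultimately have "(?A\<^sup>2 + ?B\<^sup>2) / 2 \<le> M\<^sup>2 * inverse (real k ^ 2)"
      by blast
    then show "norm \<bar>integral {0..pi} (\<lambda>\<theta>. autocorr \<theta> * cos (real k * \<theta>))\<bar> \<le> M\<^sup>2 * inverse (real k ^ 2)"
      unfolding integral_autocorr_cos by simp
  qed
qed

definition visual_series_term :: "nat \<Rightarrow> nat \<Rightarrow> real" where
  "visual_series_term m k = (-1) ^ (k div 2 + 1) * ((real k)\<^sup>2 - 1)
     * rGamma ((real m + 1 + real k) / 2) * rGamma ((real m + 1 - real k) / 2) * fourier_power k"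

text \<open>
  The number \<open>(m + 1 - k) / 2\<close> is a non-positive integer, a zero of the reciprocal Gamma function.
\<close>

lemma visual_series_term_vanishes:
  assumes "odd m" "even k" "k > m"
  shows "visual_series_term m k = 0"
proof -
  have "even (int m + 1 - int k)" using assms by simp
  then obtain j where j: "int m + 1 - int k = 2 * j" by blast
  then have "j \<le> 0" using assms by linarith
  moreover have "(real m + 1 - real k) / 2 = of_int j"
    using arg_cong[OF j, of real_of_int] by simp
  ultimately have "rGamma ((real m + 1 - real k) / 2) = 0"
    by (simp add: rGamma_eq_zero_iff nonpos_Ints_of_int)
  then show ?thesis by (simp add: visual_series_term_def)
qed

text \<open>
  Parseval applied to the autocorrelation and the kernel. Absolute convergence allows the passage from the series
  over all \<open>k\<close> to the unordered sum over even \<open>k \<ge> 2\<close>.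
\<close>

lemma integral_tangent_product_series:
  fixes m :: nat
  assumes m: "m \<ge> 3"
  defines "E \<equiv> {k::nat. 2 \<le> k \<and> even k}"
    and "A \<equiv> pi * fact m / (2 ^ (m - 1) * (real m - 2) * (Gamma ((real m + 1) / 2))\<^sup>2) * (2 * pi * (fourier_cos_coeff p 0)\<^sup>2)"
    and "B \<equiv> pi\<^sup>2 * fact m / (2 ^ (m - 1) * (real m - 2))"
    and "I \<equiv> integral {0..pi} (\<lambda>\<theta>. integral {0..2*pi} (\<lambda>\<phi>. sin \<theta> ^ (m - 3) * tangent_product \<phi> \<theta>))"
  shows "visual_series_term m summable_on E"
    and "I = A + B * (\<Sum>\<^sub>\<infinity>k\<in>E. visual_series_term m k)"
proof -
  define n where "n = m - 3"
  have mn: "m = n + 3" using m by (simp add: n_def)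
  define r where "r k = integral {0..pi} (\<lambda>\<theta>. autocorr \<theta> * cos (real k * \<theta>))" for k
  define G where "G k = integral {0..pi} (\<lambda>x. cos (real k * x) * sine_kernel n x)" for k
  define t where "t k = cosine_weight k * r k * G k" for k
  have sums: "t sums I"
    using parseval_cosine[OF continuous_on_autocorr[of 0 pi] continuous_on_sine_kernel[of _ n], of r]
      summable_integral_autocorr_cos
    unfolding t_def G_def I_def n_def[symmetric] integral_tangent_product r_def by blast
  have "compact (sine_kernel n ` {0..pi})"
    by (intro compact_continuous_image continuous_intros) auto
  then obtain M where M: "M > 0" "\<And>x. x \<in> {0..pi} \<Longrightarrow> \<bar>sine_kernel n x\<bar> \<le> M"
    using compact_imp_bounded by (force simp: bounded_pos)
  have G_le: "\<bar>G k\<bar> \<le> M * pi" for k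
  proof -
    have "norm (integral {0..pi} (\<lambda>x. cos (real k * x) * sine_kernel n x)) \<le> M * (pi - 0)"
    proof (rule integral_bound)
      fix x assume "x \<in> {0..pi}"
      then have "\<bar>cos (real k * x)\<bar> * \<bar>sine_kernel n x\<bar> \<le> 1 * M" using M by (intro mult_mono) auto
      then show "norm (cos (real k * x) * sine_kernel n x) \<le> M" by (simp add: abs_mult)
    qed (auto intro!: continuous_intros)
    then show ?thesis by (simp add: G_def)
  qed
  have abs: "summable (\<lambda>k. norm (t k))"
  proof (rule summable_comparison_test'[of "\<lambda>k. (2 * M) * \<bar>r k\<bar>" 0])
    show "summable (\<lambda>k. (2 * M) * \<bar>r k\<bar>)"
      using summable_integral_autocorr_cos by (intro summable_mult) (simp add: r_def)
    fix k :: nat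
    have "\<bar>cosine_weight k\<bar> \<le> 2 / pi" by (simp add: cosine_weight_def divide_right_mono)
    then have "\<bar>cosine_weight k\<bar> * \<bar>G k\<bar> * \<bar>r k\<bar> \<le> 2 / pi * (M * pi) * \<bar>r k\<bar>"
      using G_le[of k] M(1) by (intro mult_mono) auto
    then show "norm (norm (t k)) \<le> (2 * M) * \<bar>r k\<bar>" by (simp add: t_def abs_mult mult_ac)
  qed
  have t0: "t 0 = A"
  proof -
    have "r 0 = 2 * pi\<^sup>2 * fourier_power 0"
      unfolding r_def integral_autocorr_cos_fourier by simp
    then have "t 0 = 2 * pi * fourier_power 0 * G 0"
      by (simp add: t_def cosine_weight_def power2_eq_square)
    moreover have "fourier_power 0 = (fourier_cos_coeff p 0)\<^sup>2"
      by (simp add: fourier_power_def fourier_sin_coeff_def)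
    moreover have "G 0 = pi * fact m / (2 ^ (m - 1) * (real m - 2) * (Gamma ((real m + 1) / 2))\<^sup>2)"
    proof -
      have f: "(fact m :: real) = real m * fact (m - 1)" using m by (intro fact_reduce) simp
      have a: "real n + 3 = real m" "real n + 1 = real m - 2" "n + 2 = m - 1" "real n / 2 + 2 = (real m + 1) / 2"
        using mn by (simp_all add: field_simps)
      have "G 0 = real m / (real m - 2) * (pi * fact (m - 1) / 2 ^ (m - 1) * (rGamma ((real m + 1) / 2) * rGamma ((real m + 1) / 2)))"
        using sine_kernel_cos_coeff_even[of 0 n] unfolding G_def by (simp only: a mult_0_right of_nat_0 add_0_right diff_zero power_0) simp
      then show ?thesis unfolding f rGamma_inverse_Gamma by (simp only: power2_eq_square divide_inverse inverse_mult_distrib mult_ac)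
    qed
    ultimately show ?thesis unfolding A_def by (simp only: mult_ac)
  qed
  have t_odd: "t k = 0" if "odd k" for k
    using sine_kernel_cos_coeff_odd[OF that] by (simp add: t_def G_def)
  have t_even: "t k = B * visual_series_term m k" if kE: "k \<in> E" for k
  proof -
    obtain i where "k = 2 * i" using kE unfolding E_def by blast
    then have i: "k = 2 * i" "i \<ge> 1" using kE by (auto simp: E_def)
    have f: "(fact m :: real) = real m * fact (m - 1)" using m by (intro fact_reduce) simp
    have a: "real n + 3 = real m" "real n + 1 = real m - 2" "n + 2 = m - 1"
        "real n / 2 + 2 + real i = (real m + 1 + real k) / 2" "real n / 2 + 2 - real i = (real m + 1 - real k) / 2"
      using mn i by (simp_all add: field_simps)
    have "G k = real m * (1 - (real k)\<^sup>2) / (real m - 2) * (pi * (-1) ^ i * fact (m - 1) / 2 ^ (m - 1) *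
        (rGamma ((real m + 1 + real k) / 2) * rGamma ((real m + 1 - real k) / 2)))"
      using sine_kernel_cos_coeff_even[of i n] unfolding G_def i(1)[symmetric] a .
    moreover have "t k = pi * fourier_power k * G k"
    proof -
      have "k \<noteq> 0" using i by simp
      then have rk: "r k = pi\<^sup>2 / 2 * fourier_power k"
        unfolding r_def integral_autocorr_cos_fourier by simp
      show ?thesis
        using \<open>k \<noteq> 0\<close> unfolding t_def rk by (simp add: cosine_weight_def power2_eq_square)
    qed
    moreover have "(-1 :: real) ^ (k div 2 + 1) = - ((-1) ^ i)" using i by simp
    moreover have "pi * F * (M * (1 - k2) / N * (pi * s * f / w * (R1 * R2))) =
        pi\<^sup>2 * (M * f) / (w * N) * (- s * (k2 - 1) * R1 * R2 * F)" for F M k2 N s f w R1 R2 :: real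
      by (cases "N = 0"; cases "w = 0") (simp_all add: field_simps power2_eq_square)
    ultimately show ?thesis
      unfolding B_def visual_series_term_def f by (simp only:)
  qed
  have "(t has_sum I) UNIV"
    using norm_summable_imp_has_sum[OF abs sums] .
  also have "?this \<longleftrightarrow> (t has_sum I) (insert 0 E)"
  proof (rule has_sum_cong_neutral)
    fix k assume "k \<in> UNIV - insert 0 E"
    then have "odd k" by (auto simp: E_def)
    then show "t k = 0" by (rule t_odd)
  qed auto
  finally have "(t has_sum I) (insert 0 E)" .
  then have "(t has_sum (I - t 0)) (insert 0 E - {0})"
    by (intro has_sum_Diff) (auto intro: has_sum_finiteI)
  moreover have "insert 0 E - {0} = E" by (auto simp: E_def)
  ultimately have "(t has_sum (I - A)) E" by (simp add: t0)
  then have hs: "((\<lambda>k. B * visual_series_term m k) has_sum (I - A)) E"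
    using has_sum_cong[of E t] t_even by metis
  have B0: "B \<noteq> 0" using m by (simp add: B_def)
  have "((\<lambda>k. inverse B * (B * visual_series_term m k)) has_sum (inverse B * (I - A))) E"
    by (rule has_sum_cmult_right[OF hs])
  then have *: "(visual_series_term m has_sum (inverse B * (I - A))) E"
    using B0 by (simp add: mult.assoc[symmetric])
  then show "visual_series_term m summable_on E" by (rule has_sum_imp_summable)
  show "I = A + B * (\<Sum>\<^sub>\<infinity>k\<in>E. visual_series_term m k)"
    using infsumI[OF *] B0 by (simp add: mult.assoc[symmetric])
qed

end

section \<open>Support functions and points of contact\<close>

text \<open>
  The unit vector at angle \<open>\<phi>\<close>, used as outer normal, and its derivative, the direction of the support line.
\<close>

definition dir :: "real \<Rightarrow> real^2" where "dir \<phi> = vector [cos \<phi>, sin \<phi>]"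
definition perp :: "real \<Rightarrow> real^2" where "perp \<phi> = vector [- sin \<phi>, cos \<phi>]"

lemma inner_real2: "x \<bullet> y = x $ 1 * y $ 1 + x $ 2 * y $ 2" for x y :: "real^2"
  by (simp add: inner_vec_def UNIV_2)

lemma vec2_eq_iff: "x = y \<longleftrightarrow> x $ 1 = y $ 1 \<and> x $ 2 = y $ 2" for x y :: "real^2"
  by (simp add: vec_eq_iff forall_2)

lemma dir_nth [simp]: "dir \<phi> $ 1 = cos \<phi>" "dir \<phi> $ 2 = sin \<phi>"
  and perp_nth [simp]: "perp \<phi> $ 1 = - sin \<phi>" "perp \<phi> $ 2 = cos \<phi>"
  by (simp_all add: dir_def perp_def)

lemma inner_dir_perp [simp]:
  "dir a \<bullet> dir b = cos (b - a)" "perp a \<bullet> perp b = cos (b - a)"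
  "dir a \<bullet> perp b = - sin (b - a)" "perp a \<bullet> dir b = sin (b - a)"
  by (simp_all add: inner_real2 cos_diff sin_diff algebra_simps)

lemma norm_dir [simp]: "norm (dir a) = 1" "norm (perp a) = 1"
  by (simp_all add: norm_eq_sqrt_inner)

lemma dir_perp_expand: "x = (x \<bullet> dir a) *\<^sub>R dir a + (x \<bullet> perp a) *\<^sub>R perp a"
proof -
  have c2: "cos a * cos a = 1 - sin a * sin a" 
    using sin_cos_squared_add[of a] by (simp add: power2_eq_square algebra_simps)
  have c3: "cos a * (cos a * y) = y - sin a * (sin a * y)" for y
    using c2 by (simp add: mult.assoc[symmetric] left_diff_distrib)
  show ?thesis by (simp add: vec2_eq_iff inner_real2 algebra_simps c2 c3)
qed

lemma dir_add_pi [simp]: "dir (a + pi) = - dir a" "dir (a - pi) = - dir a"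
  "perp (a + pi) = - perp a" "perp (a - pi) = - perp a"
  by (simp_all add: vec2_eq_iff)

lemma dir_add_2pi [simp]: "dir (a + 2 * pi) = dir a" "perp (a + 2 * pi) = perp a"
  by (simp_all add: vec2_eq_iff)

lemma exists_dir:
  fixes v :: "real^2"
  assumes "norm v = 1"
  obtains a where "0 \<le> a" "a < 2 * pi" "v = dir a"
proof -
  have "(v $ 1)\<^sup>2 + (v $ 2)\<^sup>2 = 1"
    using assms by (simp add: norm_eq_sqrt_inner inner_real2 power2_eq_square)
  then obtain t where "0 \<le> t" "t < 2 * pi" "v $ 1 = cos t" "v $ 2 = sin t"
    using sincos_total_2pi by metis
  then show thesis using that[of t] by (simp add: vec2_eq_iff)
qed

lemma orthogonal_to_perp:
  assumes "v \<bullet> dir a = 0"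
  shows "v = (v \<bullet> perp a) *\<^sub>R perp a"
  using dir_perp_expand[of v a] assms by simp

lemma C2_functionE:
  fixes f :: "real \<Rightarrow> 'a::real_normed_vector"
  assumes "C2_function f"
  obtains f' f'' where "\<And>t. (f has_vector_derivative f' t) (at t)"
    "\<And>t. (f' has_vector_derivative f'' t) (at t)" "continuous_on UNIV f''"
  using assms unfolding C2_function_def C1_differentiable_on_def by auto

locale smooth_oval =
  fixes K :: "(real^2) set" and \<gamma> :: "real \<Rightarrow> real^2" and p dp ddp :: "real \<Rightarrow> real"
  assumes compact_K: "compact K" and convex_K: "convex K" and boundary: "C2_boundary K \<gamma>"
    and p_def: "p = support_function K"
    and p_deriv: "\<And>x. (p has_real_derivative dp x) (at x)"
    and dp_deriv: "\<And>x. (dp has_real_derivative ddp x) (at x)"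
    and ddp_cont: "continuous_on UNIV ddp"
begin

lemma p_eq: "p \<phi> = (SUP x\<in>K. x \<bullet> dir \<phi>)"
  by (simp add: p_def support_function_def inner_real2)

lemma support_function_periodic: "p (\<phi> + 2 * pi) = p \<phi>"
  by (simp add: p_eq)

lemma support_function_continuous: "continuous_on S p"
  using p_deriv DERIV_isCont continuous_at_imp_continuous_on by blast

text \<open>
  The closed curve is given on \<open>[0, 1)\<close>; periodicity extends it to the line.
\<close>

lemma frontier_param: "range \<gamma> = frontier K"
proof -
  have per: "\<gamma> (t + 1) = \<gamma> t" for t using boundary by (simp add: C2_boundary_def)
  have perz: "\<gamma> (t + of_int i) = \<gamma> t" for t i
  proof (induction i rule: int_induct[where k=0])
    case (step1 i) then show ?case using per[of "t + of_int i"] by (simp add: add.assoc)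
  next
    case (step2 i) then show ?case using per[of "t + of_int (i - 1)"] by (simp add: add.assoc)
  qed simp
  have "\<gamma> t \<in> \<gamma> ` {0..<1}" for t
  proof -
    have "\<gamma> (frac t) = \<gamma> t" using perz[of "frac t" "\<lfloor>t\<rfloor>"] by (simp add: frac_def)
    moreover have "frac t \<in> {0..<1}" by (simp add: frac_lt_1)
    ultimately show ?thesis by (metis imageI)
  qed
  then have "range \<gamma> = \<gamma> ` {0..<1}" by auto
  then show ?thesis using boundary by (simp add: C2_boundary_def)
qed

lemma frontier_subset_K: "frontier K \<subseteq> K"
  using compact_K by (simp add: compact_imp_closed frontier_subset_closed)

lemma K_nonempty: "K \<noteq> {}"
  using frontier_param frontier_subset_K by auto

lemma inner_le_p: "x \<in> K \<Longrightarrow> x \<bullet> dir \<phi> \<le> p \<phi>"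
  unfolding p_eq
proof (rule cSUP_upper)
  have "compact ((\<lambda>x. x \<bullet> dir \<phi>) ` K)"
    by (intro compact_continuous_image compact_K continuous_intros)
  then show "bdd_above ((\<lambda>x. x \<bullet> dir \<phi>) ` K)"
    by (simp add: bounded_imp_bdd_above compact_imp_bounded)
qed

lemma p_attained: "\<exists>x\<in>K. x \<bullet> dir \<phi> = p \<phi>"
proof -
  have "continuous_on K (\<lambda>x. x \<bullet> dir \<phi>)" by (intro continuous_intros)
  then obtain x where x: "x \<in> K" "\<And>y. y \<in> K \<Longrightarrow> y \<bullet> dir \<phi> \<le> x \<bullet> dir \<phi>"
    using continuous_attains_sup[OF compact_K K_nonempty] by blast
  then have "p \<phi> \<le> x \<bullet> dir \<phi>" unfolding p_eq by (intro cSUP_least K_nonempty)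
  then show ?thesis using x inner_le_p[of x \<phi>] by force
qed

text \<open>
  The point of contact of the support line with outer normal \<open>dir \<phi>\<close>; see the next lemma.
\<close>

definition support_point :: "real \<Rightarrow> real^2" where
  "support_point \<phi> = p \<phi> *\<^sub>R dir \<phi> + dp \<phi> *\<^sub>R perp \<phi>"

text \<open>
  The function \<open>\<psi> \<mapsto> p(\<psi>) - x \<bullet> dir \<psi>\<close> is nonnegative and vanishes at \<open>\<phi>\<close>, so its derivative vanishes there, and
  this determines the second coordinate of \<open>x\<close>. Differentiability of \<open>p\<close> thus rules out segments in the boundary.
\<close>

lemma support_point_unique:
  assumes "x \<in> K" "x \<bullet> dir \<phi> = p \<phi>"
  shows "x = support_point \<phi>"
proof -
  have "((\<lambda>\<psi>. p \<psi> - x \<bullet> dir \<psi>) has_real_derivative dp \<phi> - x \<bullet> perp \<phi>) (at \<phi>)"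
    unfolding inner_real2 dir_nth perp_nth
    by (rule derivative_eq_intros p_deriv refl | simp)+
  moreover have "p \<phi> - x \<bullet> dir \<phi> \<le> p \<psi> - x \<bullet> dir \<psi>" for \<psi>
    using assms inner_le_p[OF assms(1)] by simp
  ultimately have "dp \<phi> - x \<bullet> perp \<phi> = 0"
    by (intro DERIV_local_min[of "\<lambda>\<psi>. p \<psi> - x \<bullet> dir \<psi>" _ \<phi> 1]) auto
  then show ?thesis
    using dir_perp_expand[of x \<phi>] assms by (simp add: support_point_def)
qed

lemma support_point_in_K: "support_point \<phi> \<in> K"
  using p_attained support_point_unique by metis

lemma support_point_inner [simp]:
  "support_point \<phi> \<bullet> dir \<phi> = p \<phi>" "support_point \<phi> \<bullet> perp \<phi> = dp \<phi>"
  by (simp_all add: support_point_def inner_add_left)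

lemma p_eq_support_point: "x \<bullet> dir \<phi> = p \<phi> \<Longrightarrow> x = support_point \<phi> + (x \<bullet> perp \<phi> - dp \<phi>) *\<^sub>R perp \<phi>"
  using dir_perp_expand[of x \<phi>] by (simp add: support_point_def algebra_simps)

lemma not_in_K_separated:
  assumes "P \<notin> K"
  obtains \<phi> where "0 \<le> \<phi>" "\<phi> < 2 * pi" "p \<phi> < P \<bullet> dir \<phi>"
proof -
  obtain a b where ab: "a \<bullet> P < b" "\<And>x. x \<in> K \<Longrightarrow> b < a \<bullet> x"
    using separating_hyperplane_closed_point[OF convex_K compact_imp_closed[OF compact_K] assms] by auto
  have a0: "a \<noteq> 0" using ab K_nonempty by force
  then have "norm (- a /\<^sub>R norm a) = 1" by simp
  then obtain \<phi> where \<phi>: "0 \<le> \<phi>" "\<phi> < 2 * pi" "- a /\<^sub>R norm a = dir \<phi>" by (rule exists_dir)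
  then have "a = - norm a *\<^sub>R dir \<phi>" using a0 by (simp add: \<phi>(3)[symmetric])
  then have inner: "a \<bullet> x = - norm a * (x \<bullet> dir \<phi>)" for x
    by (metis inner_commute inner_scaleR_right)
  have "a \<bullet> P < a \<bullet> support_point \<phi>" using ab support_point_in_K by (meson less_trans)
  then have "p \<phi> < P \<bullet> dir \<phi>" using a0 unfolding inner by (simp add: mult_less_cancel_left)
  then show thesis using that \<phi> by blast
qed

text \<open>
  If all support lines stay at positive distance from \<open>x\<close>, then by compactness a whole ball about \<open>x\<close> satisfies every
  support inequality and so lies in \<open>K\<close>.
\<close>

lemma frontier_support:
  assumes "x \<in> frontier K"
  obtains \<phi> where "0 \<le> \<phi>" "\<phi> < 2 * pi" "x = support_point \<phi>"
proof -
  have xK: "x \<in> K" using assms frontier_subset_K by blast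
  have "\<exists>\<phi>\<in>{0..2*pi}. p \<phi> - x \<bullet> dir \<phi> \<le> 0"
  proof (rule ccontr)
    assume "\<not> ?thesis"
    then have pos: "\<And>\<phi>. \<phi> \<in> {0..2*pi} \<Longrightarrow> 0 < p \<phi> - x \<bullet> dir \<phi>" by force
    have "continuous_on {0..2*pi} (\<lambda>\<phi>. p \<phi> - x \<bullet> dir \<phi>)"
      unfolding inner_real2 dir_nth by (intro continuous_intros support_function_continuous)
    then obtain m where m: "m \<in> {0..2*pi}" "\<And>\<phi>. \<phi> \<in> {0..2*pi} \<Longrightarrow> p m - x \<bullet> dir m \<le> p \<phi> - x \<bullet> dir \<phi>"
      using continuous_attains_inf[of "{0..2*pi}" "\<lambda>\<phi>. p \<phi> - x \<bullet> dir \<phi>"] by auto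
    let ?d = "p m - x \<bullet> dir m"
    have "ball x ?d \<subseteq> K"
    proof
      fix y assume y: "y \<in> ball x ?d"
      show "y \<in> K"
      proof (rule ccontr)
        assume "y \<notin> K"
        then obtain \<phi> where \<phi>: "0 \<le> \<phi>" "\<phi> < 2 * pi" "p \<phi> < y \<bullet> dir \<phi>" by (rule not_in_K_separated)
        have "(y - x) \<bullet> dir \<phi> \<le> norm (y - x)" using norm_cauchy_schwarz[of "y - x" "dir \<phi>"] by simp
        also have "\<dots> < ?d" using y by (simp add: dist_norm norm_minus_commute)
        also have "\<dots> \<le> p \<phi> - x \<bullet> dir \<phi>" using m \<phi> by auto
        finally show False using \<phi> by (simp add: inner_diff_left)
      qed
    qed
    then have "x \<in> interior K" using pos[OF m(1)] mem_interior by blast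
    then show False using assms by (simp add: frontier_def)
  qed
  then obtain \<phi> where \<phi>: "\<phi> \<in> {0..2*pi}" "p \<phi> - x \<bullet> dir \<phi> \<le> 0" by blast
  then have x: "x = support_point \<phi>"
    using inner_le_p[OF xK, of \<phi>] by (intro support_point_unique xK) simp
  show thesis
  proof (cases "\<phi> = 2 * pi")
    case True
    have "x \<bullet> dir 0 = p 0"
      using x True support_point_inner(1)[of \<phi>] support_function_periodic[of 0] dir_add_2pi(1)[of 0] by (metis add_0)
    then show ?thesis using support_point_unique[OF xK] that[of 0] by simp
  next
    case False
    then show ?thesis using \<phi> x that[of \<phi>] by simp
  qed
qed

lemma support_point_in_frontier: "support_point \<phi> \<in> frontier K"
proof -
  have "support_point \<phi> \<notin> interior K"
  proof
    assume "support_point \<phi> \<in> interior K"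
    then obtain e where e: "e > 0" "cball (support_point \<phi>) e \<subseteq> K"
      using mem_interior_cball by blast
    have "support_point \<phi> + e *\<^sub>R dir \<phi> \<in> K"
      using e by (intro subsetD[OF e(2)]) (simp add: dist_norm)
    from inner_le_p[OF this, of \<phi>] e show False by (simp add: inner_add_left)
  qed
  then show ?thesis using support_point_in_K closure_subset by (auto simp: frontier_def)
qed

lemma \<gamma>_deriv: "(\<gamma> has_vector_derivative vector_derivative \<gamma> (at t)) (at t)"
  and \<gamma>_regular: "vector_derivative \<gamma> (at t) \<noteq> 0"
  using boundary unfolding C2_boundary_def C2_function_def by (metis vector_derivative_at)+

lemma tangent_orthogonal:
  assumes "\<gamma> t = support_point \<phi>"
  shows "vector_derivative \<gamma> (at t) \<bullet> dir \<phi> = 0"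
proof -
  have "((\<lambda>s. \<gamma> s \<bullet> dir \<phi>) has_real_derivative vector_derivative \<gamma> (at t) \<bullet> dir \<phi>) (at t)"
    using bounded_linear.has_vector_derivative[OF bounded_linear_inner_left \<gamma>_deriv]
    by (simp add: has_real_derivative_iff_has_vector_derivative)
  moreover have "\<gamma> s \<bullet> dir \<phi> \<le> \<gamma> t \<bullet> dir \<phi>" for s
    using frontier_param frontier_subset_K inner_le_p[of "\<gamma> s" \<phi>] assms by auto
  ultimately show ?thesis
    by (intro DERIV_local_max[of "\<lambda>s. \<gamma> s \<bullet> dir \<phi>" _ t 1]) auto
qed

lemma K_not_singleton: "K \<noteq> {x}"
proof
  assume K: "K = {x}"
  then have "\<gamma> 0 = \<gamma> (1/2)" using frontier_param frontier_subset_K by (metis rangeI singletonD subsetD)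
  moreover have "inj_on \<gamma> {0..<1}" using boundary by (simp add: C2_boundary_def)
  ultimately have "(0::real) = 1/2" using inj_onD[of \<gamma> "{0..<1}" 0 "1/2"] by simp
  then show False by simp
qed

text \<open>
  If two opposite support lines coincide, then all of \<open>K\<close> lies on one support line, so \<open>K\<close> is a single
  point, which no injective closed curve can trace.
\<close>

lemma width_pos: "0 < p \<phi> + p (\<phi> + pi)"
proof (rule ccontr)
  assume "\<not> ?thesis"
  then have le: "p (\<phi> + pi) \<le> - p \<phi>" by simp
  have "x = support_point \<phi>" if "x \<in> K" for x
  proof (rule support_point_unique[OF that])
    have "- (x \<bullet> dir \<phi>) \<le> p (\<phi> + pi)" using inner_le_p[OF that, of "\<phi> + pi"] by simp
    then show "x \<bullet> dir \<phi> = p \<phi>" using le inner_le_p[OF that, of \<phi>] by linarith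
  qed
  then show False using K_not_singleton[of "support_point \<phi>"] support_point_in_K by blast
qed

text \<open>
  The tangent of \<open>\<gamma>\<close> at a boundary point is a nonzero vector orthogonal to every outer normal there, and opposite
  normals are excluded by the positive width.
\<close>

lemma support_point_eq_imp:
  assumes "support_point \<phi> = support_point \<psi>"
  shows "sin (\<psi> - \<phi>) = 0" and "cos (\<psi> - \<phi>) \<noteq> -1"
proof -
  obtain t where t: "\<gamma> t = support_point \<phi>"
    using support_point_in_frontier[of \<phi>] unfolding frontier_param[symmetric] by auto
  let ?v = "vector_derivative \<gamma> (at t)"
  have "?v = (?v \<bullet> perp \<phi>) *\<^sub>R perp \<phi>" using orthogonal_to_perp tangent_orthogonal[OF t] by blast
  moreover have "?v \<bullet> dir \<psi> = 0" using tangent_orthogonal[of t \<psi>] t assms by simp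
  ultimately have "(?v \<bullet> perp \<phi>) * sin (\<psi> - \<phi>) = 0" by (metis inner_dir_perp(4) inner_scaleR_left)
  moreover have "?v \<bullet> perp \<phi> \<noteq> 0" using \<open>?v = _\<close> \<gamma>_regular[of t] by (metis scale_zero_left)
  ultimately show s0: "sin (\<psi> - \<phi>) = 0" by simp
  show "cos (\<psi> - \<phi>) \<noteq> -1"
  proof
    assume c: "cos (\<psi> - \<phi>) = -1"
    have \<psi>: "\<psi> = \<phi> + (\<psi> - \<phi>)" by simp
    have "dir \<psi> = - dir \<phi>"
      by (subst \<psi>) (simp only: vec2_eq_iff dir_nth vector_uminus_component cos_add sin_add s0 c, simp)
    moreover have "dir (\<phi> + pi) = - dir \<phi>" by simp
    ultimately have "p \<psi> = p (\<phi> + pi)" by (simp only: p_eq)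
    moreover have "p \<psi> = - p \<phi>"
      using support_point_inner(1)[of \<psi>] assms \<open>dir \<psi> = - dir \<phi>\<close> by (metis inner_minus_right support_point_inner(1))
    ultimately show False using width_pos[of \<phi>] by simp
  qed
qed

end

section \<open>Exterior points as intersections of two support lines\<close>

context smooth_oval
begin

sublocale C2_periodic p dp ddp
  by unfold_locales (rule p_deriv dp_deriv ddp_cont support_function_periodic)+

lemma support_point_add_2pi [simp]: "support_point (\<phi> + 2 * pi) = support_point \<phi>"
  by (simp add: support_point_def p_periodic dp_periodic)

text \<open>
  The signed distance from \<open>P\<close> to a support line, negative when the line separates \<open>P\<close> from \<open>K\<close>. Its zeros are the
  normals of the support lines through \<open>P\<close>.
\<close>

definition gap :: "real^2 \<Rightarrow> real \<Rightarrow> real" where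
  "gap P \<phi> = p \<phi> - P \<bullet> dir \<phi>"

lemma gap_add_2pi [simp]: "gap P (\<phi> + 2 * pi) = gap P \<phi>"
  by (simp add: gap_def p_periodic)

lemma gap_opposite: "0 < gap P \<phi> + gap P (\<phi> + pi)"
  using width_pos[of \<phi>] by (simp add: gap_def)

lemma dir_between: "sin (b - a) *\<^sub>R dir x = sin (b - x) *\<^sub>R dir a + sin (x - a) *\<^sub>R dir b"
proof -
  have c2: "cos t * cos t = 1 - sin t * sin t" for t :: real
    using sin_cos_squared_add[of t] by (simp add: power2_eq_square algebra_simps)
  then have c3: "cos t * (cos t * y) = y - sin t * (sin t * y)" for t y :: real
    by (simp add: mult.assoc[symmetric] left_diff_distrib)
  show ?thesis by (simp add: vec2_eq_iff sin_diff algebra_simps c2 c3)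
qed

text \<open>
  Convexity of the positively homogeneous extension of the support function, written on the unit circle. Equality forces
  the three support lines to share their point of contact.
\<close>

lemma gap_between:
  assumes "a \<le> x" "x \<le> b" "b \<le> a + pi"
  shows "sin (b - a) * gap P x \<le> sin (b - x) * gap P a + sin (x - a) * gap P b"
    and "sin (b - a) * gap P x = sin (b - x) * gap P a + sin (x - a) * gap P b \<Longrightarrow>
      a < x \<Longrightarrow> x < b \<Longrightarrow> b < a + pi \<Longrightarrow> support_point x = support_point a \<and> support_point x = support_point b"
proof -
  let ?y = "support_point x"
  have nn: "0 \<le> sin (b - x)" "0 \<le> sin (x - a)" using assms by (auto intro!: sin_ge_zero)
  have le: "?y \<bullet> dir a \<le> p a" "?y \<bullet> dir b \<le> p b"
    using inner_le_p[OF support_point_in_K] by auto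
  have lin: "sin (b - a) * (z \<bullet> dir x) = sin (b - x) * (z \<bullet> dir a) + sin (x - a) * (z \<bullet> dir b)" for z
  proof -
    have "z \<bullet> (sin (b - a) *\<^sub>R dir x) = z \<bullet> (sin (b - x) *\<^sub>R dir a + sin (x - a) *\<^sub>R dir b)"
      using dir_between[of b a x] by (rule arg_cong)
    then show ?thesis by (simp only: inner_add_right inner_scaleR_right)
  qed
  have *: "sin (b - x) * gap P a + sin (x - a) * gap P b - sin (b - a) * gap P x =
     sin (b - x) * (p a - ?y \<bullet> dir a) + sin (x - a) * (p b - ?y \<bullet> dir b)"
    using lin[of P] lin[of ?y] unfolding gap_def right_diff_distrib support_point_inner by linarith
  have t: "0 \<le> sin (b - x) * (p a - ?y \<bullet> dir a)" "0 \<le> sin (x - a) * (p b - ?y \<bullet> dir b)"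
    using nn le by simp_all
  then show "sin (b - a) * gap P x \<le> sin (b - x) * gap P a + sin (x - a) * gap P b"
    using * by linarith
  assume eq: "sin (b - a) * gap P x = sin (b - x) * gap P a + sin (x - a) * gap P b"
    and strict: "a < x" "x < b" "b < a + pi"
  have "0 < sin (b - x)" "0 < sin (x - a)" using strict by (auto intro!: sin_gt_zero)
  moreover have "sin (b - x) * (p a - ?y \<bullet> dir a) = 0" "sin (x - a) * (p b - ?y \<bullet> dir b) = 0"
    using t * eq by linarith+
  ultimately have "?y \<bullet> dir a = p a" "?y \<bullet> dir b = p b" by auto
  then show "?y = support_point a \<and> ?y = support_point b"
    using support_point_unique[OF support_point_in_K] by blast
qed

lemma support_point_neq: "0 < \<theta> \<Longrightarrow> \<theta> < pi \<Longrightarrow> support_point \<phi> \<noteq> support_point (\<phi> + \<theta>)"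
  using support_point_eq_imp(1)[of \<phi> "\<phi> + \<theta>"] sin_gt_zero[of \<theta>] by auto

text \<open>
  Convexity gives \<open>gap P x \<le> 0\<close>; equality would make one boundary point the point of contact of two different normals.
\<close>

lemma gap_neg_between:
  assumes "gap P a = 0" "gap P b = 0" "a < x" "x < b" "b < a + pi"
  shows "gap P x < 0"
proof -
  have "0 < sin (b - a)" using assms by (intro sin_gt_zero) auto
  moreover have "sin (b - a) * gap P x \<le> 0"
    using gap_between(1)[of a x b P] assms by simp
  moreover have "gap P x \<noteq> 0"
  proof
    assume "gap P x = 0"
    then have "support_point a = support_point b"
      using gap_between(2)[of a x b P] assms by (metis less_imp_le mult_zero_right add_0)
    then show False using support_point_neq[of "b - a" a] assms by simp
  qed
  ultimately show ?thesis by (smt (verit) mult_pos_pos)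
qed

text \<open>
  The intersection of the support lines with normals at \<open>\<phi>\<close> and \<open>\<phi> + \<theta>\<close>: the coefficient of \<open>perp \<phi>\<close> solves the
  equation of the second line.
\<close>

definition meet :: "real \<Rightarrow> real \<Rightarrow> real^2" where
  "meet \<phi> \<theta> = p \<phi> *\<^sub>R dir \<phi> + ((p (\<phi> + \<theta>) - p \<phi> * cos \<theta>) / sin \<theta>) *\<^sub>R perp \<phi>"

lemma gap_meet:
  assumes "0 < \<theta>" "\<theta> < pi"
  shows "gap (meet \<phi> \<theta>) \<phi> = 0" "gap (meet \<phi> \<theta>) (\<phi> + \<theta>) = 0"
  using sin_gt_zero[of \<theta>] assms by (simp_all add: gap_def meet_def inner_add_left)

lemma meet_unique:
  assumes "0 < \<theta>" "\<theta> < pi" "gap P \<phi> = 0" "gap P (\<phi> + \<theta>) = 0"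
  shows "P = meet \<phi> \<theta>"
proof -
  have s: "0 < sin \<theta>" using assms sin_gt_zero by blast
  have P: "P = p \<phi> *\<^sub>R dir \<phi> + (P \<bullet> perp \<phi>) *\<^sub>R perp \<phi>"
    using dir_perp_expand[of P \<phi>] assms(3) by (simp add: gap_def)
  have "p (\<phi> + \<theta>) = P \<bullet> dir (\<phi> + \<theta>)" using assms(4) by (simp add: gap_def)
  also have "\<dots> = p \<phi> * cos \<theta> + (P \<bullet> perp \<phi>) * sin \<theta>"
    by (subst P) (simp add: inner_add_left)
  finally have "P \<bullet> perp \<phi> = (p (\<phi> + \<theta>) - p \<phi> * cos \<theta>) / sin \<theta>" using s by (simp add: field_simps)
  then show ?thesis using P by (simp add: meet_def)
qed

lemma meet_notin_K:
  assumes "0 < \<theta>" "\<theta> < pi"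
  shows "meet \<phi> \<theta> \<notin> K"
proof
  assume K: "meet \<phi> \<theta> \<in> K"
  have "meet \<phi> \<theta> = support_point \<phi>" "meet \<phi> \<theta> = support_point (\<phi> + \<theta>)"
    using gap_meet[OF assms, of \<phi>] by (auto intro!: support_point_unique[OF K] simp: gap_def)
  then show False using support_point_neq[OF assms, of \<phi>] by simp
qed

lemma gap_cont: "continuous_on S (gap P)"
  unfolding gap_def inner_real2 dir_nth by (intro continuous_intros)

text \<open>
  A separating line has a normal \<open>c\<close> with negative gap, while the gap is positive at \<open>c + \<pi>\<close> and \<open>c - \<pi>\<close>. The
  intermediate value theorem gives one zero on each side of \<open>c\<close>. These two zeros are less than \<open>\<pi>\<close> apart: otherwise
  the normal opposite to the first one would lie between \<open>c\<close> and the second, where convexity makes the gap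
  nonpositive, whereas the gap is positive opposite a zero.
\<close>

lemma notin_K_imp_meet:
  assumes "P \<notin> K"
  obtains \<phi> \<theta> where "0 \<le> \<phi>" "\<phi> < 2 * pi" "0 < \<theta>" "\<theta> < pi" "P = meet \<phi> \<theta>"
proof -
  obtain c where c: "0 \<le> c" "c < 2 * pi" "gap P c < 0"
    using not_in_K_separated[OF assms] unfolding gap_def by (metis diff_less_0_iff_less)
  have pos: "0 < gap P (c + pi)" "0 < gap P (c - pi)"
    using gap_opposite[of P c] gap_opposite[of P "c - pi"] c by simp_all
  obtain b where b: "c \<le> b" "b \<le> c + pi" "gap P b = 0"
    using IVT'[of "gap P" c 0 "c + pi"] c pos gap_cont by auto
  obtain a where a: "c - pi \<le> a" "a \<le> c" "gap P a = 0"
    using IVT2'[of "gap P" c 0 "c - pi"] c pos gap_cont by auto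
  have ab: "c < b" "b < c + pi" "c - pi < a" "a < c"
    using a b c pos by (auto simp: less_le)
  have "b < a + pi"
  proof (rule ccontr)
    assume "\<not> ?thesis"
    then have le: "a + pi \<le> b" by simp
    have g: "0 < gap P (a + pi)" using gap_opposite[of P a] a by simp
    have s: "0 < sin (b - c)" using ab by (intro sin_gt_zero) auto
    have "sin (b - c) * gap P (a + pi) \<le> sin (b - (a + pi)) * gap P c"
      using gap_between(1)[of c "a + pi" b P] ab le b by simp
    also have "\<dots> \<le> 0"
      using ab le c(3) by (intro mult_nonneg_nonpos sin_ge_zero) auto
    finally show False using mult_pos_pos[OF s g] by linarith
  qed
  moreover have "gap P (a + (b - a)) = 0" using b by simp
  ultimately have P: "P = meet a (b - a)" using ab a by (intro meet_unique) auto
  have P2: "P = meet (a + 2 * pi) (b - a)"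
  proof (rule meet_unique)
    have "a + 2 * pi + (b - a) = b + 2 * pi" by simp
    then show "gap P (a + 2 * pi + (b - a)) = 0" using b by (simp only: gap_add_2pi)
  qed (use ab a \<open>b < a + pi\<close> in auto)
  show thesis
  proof (cases "0 \<le> a")
    case True
    then show thesis using that[of a "b - a"] P ab c \<open>b < a + pi\<close> by auto
  next
    case False
    then show thesis using that[of "a + 2 * pi" "b - a"] P2 ab c \<open>b < a + pi\<close> by auto
  qed
qed

text \<open>
  Only two support lines pass through an exterior point. Between two normals of support lines through \<open>P\<close> that are less
  than \<open>\<pi>\<close> apart the gap is negative. Hence it is positive on the closed opposite arc, and a third zero anywhere else would
  enclose one of the two given zeros.
\<close>

lemma gap_zeros:
  assumes \<theta>: "0 < \<theta>" "\<theta> < pi" and z: "gap P \<phi> = 0" "gap P (\<phi> + \<theta>) = 0"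
    and \<psi>: "\<phi> \<le> \<psi>" "\<psi> < \<phi> + 2 * pi" "gap P \<psi> = 0"
  shows "\<psi> = \<phi> \<or> \<psi> = \<phi> + \<theta>"
proof (rule ccontr)
  assume "\<not> ?thesis"
  then consider "\<phi> < \<psi>" "\<psi> < \<phi> + \<theta>" | "\<phi> + \<theta> < \<psi>" "\<psi> < \<phi> + pi" | "\<psi> = \<phi> + pi"
    | "\<phi> + pi < \<psi>" "\<psi> < \<phi> + \<theta> + pi" | "\<psi> = \<phi> + \<theta> + pi" | "\<phi> + \<theta> + pi < \<psi>"
    using \<psi>(1) by linarith
  then show False
  proof cases
    case 1
    then show False using gap_neg_between[OF z, of \<psi>] \<theta> \<psi> by simp
  next
    case 2
    then show False using gap_neg_between[OF z(1) \<psi>(3), of "\<phi> + \<theta>"] \<theta> z by simp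
  next
    case 3
    then show False using gap_opposite[of P \<phi>] z \<psi> by simp
  next
    \<comment> \<open>The opposite normal lies between the two given ones.\<close>
    case 4
    then have "gap P (\<psi> - pi) < 0" using gap_neg_between[OF z, of "\<psi> - pi"] \<theta> by simp
    then show False using gap_opposite[of P "\<psi> - pi"] \<psi> by simp
  next
    case 5
    then show False using gap_opposite[of P "\<phi> + \<theta>"] z \<psi> by simp
  next
    \<comment> \<open>One turn back, this zero and \<open>\<phi> + \<theta>\<close> enclose \<open>\<phi>\<close> within an arc shorter than \<open>\<pi>\<close>.\<close>
    case 6
    have "gap P (\<psi> - 2 * pi) = 0" using gap_add_2pi[of P "\<psi> - 2 * pi"] \<psi> by simp
    then show False using gap_neg_between[of P "\<psi> - 2 * pi" "\<phi> + \<theta>" \<phi>] 6 \<theta> \<psi> z by simp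
  qed
qed

lemma meet_inj:
  assumes "meet \<phi> \<theta> = meet \<phi>' \<theta>'" "0 \<le> \<phi>" "\<phi> < 2 * pi" "0 \<le> \<phi>'" "\<phi>' < 2 * pi"
    "0 < \<theta>" "\<theta> < pi" "0 < \<theta>'" "\<theta>' < pi"
  shows "\<phi> = \<phi>' \<and> \<theta> = \<theta>'"
proof -
  have *: "\<phi> = \<phi>' \<and> \<theta> = \<theta>'" if "\<phi> \<le> \<phi>'" "meet \<phi> \<theta> = meet \<phi>' \<theta>'" "0 \<le> \<phi>" "\<phi>' < 2 * pi"
    "0 < \<theta>" "\<theta> < pi" "0 < \<theta>'" "\<theta>' < pi" for \<phi> \<phi>' \<theta> \<theta>'
  proof -
    let ?P = "meet \<phi> \<theta>"
    note z = gap_meet[OF that(5,6), of \<phi>] gap_meet[OF that(7,8), of \<phi>', folded that(2)]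
    have 1: "\<phi>' = \<phi> \<or> \<phi>' = \<phi> + \<theta>"
      using that by (intro gap_zeros[OF that(5,6) z(1,2)] z) auto
    have 2: "\<phi>' + \<theta>' = \<phi> \<or> \<phi>' + \<theta>' = \<phi> + \<theta>"
      using that 1 by (intro gap_zeros[OF that(5,6) z(1,2)] z) auto
    show ?thesis using 1 2 that by auto
  qed
  show ?thesis
  proof (cases "\<phi> \<le> \<phi>'")
    case True then show ?thesis using *[of \<phi> \<phi>' \<theta> \<theta>'] assms by simp
  next
    case False then show ?thesis using *[of \<phi>' \<phi> \<theta>' \<theta>] assms by simp
  qed
qed

text \<open>
  The tangent lengths \<open>T\<^sub>1\<close> and \<open>T\<^sub>2\<close>, each multiplied by \<open>sin \<theta>\<close>. They are the distances from one point of contact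
  to the other support line.
\<close>

definition first_excess :: "real \<Rightarrow> real \<Rightarrow> real" where
  "first_excess \<phi> \<theta> = p (\<phi> + \<theta>) - p \<phi> * cos \<theta> - dp \<phi> * sin \<theta>"
definition second_excess :: "real \<Rightarrow> real \<Rightarrow> real" where
  "second_excess \<phi> \<theta> = p \<phi> - p (\<phi> + \<theta>) * cos \<theta> + dp (\<phi> + \<theta>) * sin \<theta>"

lemma excess_pos:
  assumes "0 < \<theta>" "\<theta> < pi"
  shows "0 < first_excess \<phi> \<theta>" "0 < second_excess \<phi> \<theta>"
proof -
  have 1: "first_excess \<phi> \<theta> = p (\<phi> + \<theta>) - support_point \<phi> \<bullet> dir (\<phi> + \<theta>)"
    by (simp add: first_excess_def support_point_def inner_add_left)
  have 2: "second_excess \<phi> \<theta> = p \<phi> - support_point (\<phi> + \<theta>) \<bullet> dir \<phi>"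
    by (simp add: second_excess_def support_point_def inner_add_left)
  have "p (\<phi> + \<theta>) \<noteq> support_point \<phi> \<bullet> dir (\<phi> + \<theta>)" "p \<phi> \<noteq> support_point (\<phi> + \<theta>) \<bullet> dir \<phi>"
    using support_point_unique[OF support_point_in_K] support_point_neq[OF assms, of \<phi>] by metis+
  then show "0 < first_excess \<phi> \<theta>" "0 < second_excess \<phi> \<theta>"
    unfolding 1 2 using inner_le_p[OF support_point_in_K] by (simp_all add: less_le)
qed

lemma meet_eq_support_point:
  assumes "0 < \<theta>" "\<theta> < pi"
  shows "meet \<phi> \<theta> = support_point \<phi> + (first_excess \<phi> \<theta> / sin \<theta>) *\<^sub>R perp \<phi>"
    and "meet \<phi> \<theta> = support_point (\<phi> + \<theta>) - (second_excess \<phi> \<theta> / sin \<theta>) *\<^sub>R perp (\<phi> + \<theta>)"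
proof -
  have s: "sin \<theta> \<noteq> 0" using sin_gt_zero assms by force
  have "(p (\<phi> + \<theta>) - p \<phi> * cos \<theta>) / sin \<theta> = dp \<phi> + first_excess \<phi> \<theta> / sin \<theta>"
    using s by (simp add: first_excess_def diff_divide_distrib)
  then show "meet \<phi> \<theta> = support_point \<phi> + (first_excess \<phi> \<theta> / sin \<theta>) *\<^sub>R perp \<phi>"
    unfolding meet_def support_point_def by (simp only: scaleR_left_distrib add.assoc)
  have "meet \<phi> \<theta> \<bullet> perp (\<phi> + \<theta>) = dp (\<phi> + \<theta>) - second_excess \<phi> \<theta> / sin \<theta>"
  proof -
    have c2: "cos \<theta> * cos \<theta> = 1 - sin \<theta> * sin \<theta>"
      using sin_cos_squared_add[of \<theta>] by (simp add: power2_eq_square algebra_simps)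
    have "meet \<phi> \<theta> \<bullet> perp (\<phi> + \<theta>) = - p \<phi> * sin \<theta> + (p (\<phi> + \<theta>) - p \<phi> * cos \<theta>) / sin \<theta> * cos \<theta>"
      by (simp add: meet_def inner_add_left)
    also have "\<dots> = (- p \<phi> * (sin \<theta> * sin \<theta>) + p (\<phi> + \<theta>) * cos \<theta> - p \<phi> * (cos \<theta> * cos \<theta>)) / sin \<theta>"
      using s by (simp add: field_simps)
    also have "\<dots> = (p (\<phi> + \<theta>) * cos \<theta> - p \<phi>) / sin \<theta>" unfolding c2 by (simp add: algebra_simps)
    also have "\<dots> = dp (\<phi> + \<theta>) - second_excess \<phi> \<theta> / sin \<theta>"
      using s by (simp add: second_excess_def field_simps)
    finally show ?thesis .
  qed
  moreover have "meet \<phi> \<theta> \<bullet> dir (\<phi> + \<theta>) = p (\<phi> + \<theta>)" using gap_meet[OF assms, of \<phi>] by (simp add: gap_def)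
  ultimately show "meet \<phi> \<theta> = support_point (\<phi> + \<theta>) - (second_excess \<phi> \<theta> / sin \<theta>) *\<^sub>R perp (\<phi> + \<theta>)"
    using p_eq_support_point[of "meet \<phi> \<theta>" "\<phi> + \<theta>"] by simp
qed

text \<open>
  A tangent line of \<open>\<gamma>\<close> is a support line, so a tangent direction at the exterior point belongs to a zero of the gap.
  The requirement that the ray points towards the curve selects the sign.
\<close>

lemma tangent_direction_meet:
  assumes \<phi>: "0 \<le> \<phi>" "\<phi> < 2 * pi" and \<theta>: "0 < \<theta>" "\<theta> < pi"
  shows "tangent_direction \<gamma> (meet \<phi> \<theta>) u \<longleftrightarrow> u = - perp \<phi> \<or> u = perp (\<phi> + \<theta>)"
proof
  let ?P = "meet \<phi> \<theta>"
  have s0: "0 < sin \<theta>" using sin_gt_zero \<theta> by blast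
  note pos = excess_pos[OF \<theta>, of \<phi>] 
  note z = gap_meet[OF \<theta>, of \<phi>]
  assume "tangent_direction \<gamma> ?P u"
  then obtain t s c where u: "norm u = 1" and s: "0 < s" "\<gamma> t = ?P + s *\<^sub>R u"
    and c: "vector_derivative \<gamma> (at t) = c *\<^sub>R u"
    unfolding tangent_direction_def by blast
  have "\<gamma> t \<in> frontier K" using frontier_param by blast
  then obtain \<psi>0 where \<psi>0: "0 \<le> \<psi>0" "\<psi>0 < 2 * pi" "\<gamma> t = support_point \<psi>0" by (rule frontier_support)
  \<comment> \<open>The normal is moved into the turn that starts at \<open>\<phi>\<close>.\<close>
  obtain \<psi> where \<psi>: "\<phi> \<le> \<psi>" "\<psi> < \<phi> + 2 * pi" "\<gamma> t = support_point \<psi>"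
  proof (cases "\<phi> \<le> \<psi>0")
    case True then show thesis using that[of \<psi>0] \<psi>0 \<phi> by simp
  next
    case False then show thesis using that[of "\<psi>0 + 2 * pi"] \<psi>0 \<phi> by simp
  qed
  have "c \<noteq> 0" using c \<gamma>_regular[of t] by auto
  then have "u \<bullet> dir \<psi> = 0" using tangent_orthogonal[OF \<psi>(3)] c by simp
  then have "gap ?P \<psi> = 0"
    using arg_cong[OF s(2), of "\<lambda>x. x \<bullet> dir \<psi>"] \<psi>(3) by (simp add: gap_def inner_add_left)
  then have "\<psi> = \<phi> \<or> \<psi> = \<phi> + \<theta>" by (rule gap_zeros[OF \<theta> z \<psi>(1,2)])
  then show "u = - perp \<phi> \<or> u = perp (\<phi> + \<theta>)"
  proof
    assume "\<psi> = \<phi>"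
    then have su: "s *\<^sub>R u = - (first_excess \<phi> \<theta> / sin \<theta>) *\<^sub>R perp \<phi>"
      using s(2) \<psi>(3) meet_eq_support_point(1)[OF \<theta>, of \<phi>]
      by (simp add: eq_neg_iff_add_eq_0 add.commute)
    then have "norm (s *\<^sub>R u) = first_excess \<phi> \<theta> / sin \<theta>" using pos s0 by simp
    then have "s = first_excess \<phi> \<theta> / sin \<theta>" using u s by simp
    then have "s *\<^sub>R u = s *\<^sub>R (- perp \<phi>)" using su by simp
    then show ?thesis using s(1) by (simp only: scaleR_cancel_left) simp
  next
    assume "\<psi> = \<phi> + \<theta>"
    then have su: "s *\<^sub>R u = (second_excess \<phi> \<theta> / sin \<theta>) *\<^sub>R perp (\<phi> + \<theta>)"
      using s(2) \<psi>(3) meet_eq_support_point(2)[OF \<theta>, of \<phi>] by simp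
    then have "norm (s *\<^sub>R u) = second_excess \<phi> \<theta> / sin \<theta>" using pos s0 by simp
    then have "s = second_excess \<phi> \<theta> / sin \<theta>" using u s by simp
    then have "s *\<^sub>R u = s *\<^sub>R perp (\<phi> + \<theta>)" using su by simp
    then show ?thesis using s(1) by (simp only: scaleR_cancel_left) simp
  qed
next
  let ?P = "meet \<phi> \<theta>"
  have s0: "0 < sin \<theta>" using sin_gt_zero \<theta> by blast
  note pos = excess_pos[OF \<theta>, of \<phi>]
  have ex: "\<exists>t c. \<gamma> t = support_point \<psi> \<and> vector_derivative \<gamma> (at t) = c *\<^sub>R perp \<psi>" for \<psi>
  proof -
    obtain t where t: "\<gamma> t = support_point \<psi>"
      using support_point_in_frontier[of \<psi>] unfolding frontier_param[symmetric] by auto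
    then show ?thesis using orthogonal_to_perp tangent_orthogonal[OF t] by blast
  qed
  assume "u = - perp \<phi> \<or> u = perp (\<phi> + \<theta>)"
  then show "tangent_direction \<gamma> ?P u"
  proof
    assume u: "u = - perp \<phi>"
    obtain t c where t: "\<gamma> t = support_point \<phi>" "vector_derivative \<gamma> (at t) = c *\<^sub>R perp \<phi>" using ex by blast
    have "\<gamma> t = ?P + (first_excess \<phi> \<theta> / sin \<theta>) *\<^sub>R u" "vector_derivative \<gamma> (at t) = (- c) *\<^sub>R u"
      using t meet_eq_support_point(1)[OF \<theta>, of \<phi>] u by simp_all
    moreover have "0 < first_excess \<phi> \<theta> / sin \<theta>" using pos s0 by simp
    ultimately show ?thesis unfolding tangent_direction_def using u by (metis norm_dir(2) norm_minus_cancel)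
  next
    assume u: "u = perp (\<phi> + \<theta>)"
    obtain t c where t: "\<gamma> t = support_point (\<phi> + \<theta>)" "vector_derivative \<gamma> (at t) = c *\<^sub>R perp (\<phi> + \<theta>)" using ex by blast
    have "\<gamma> t = ?P + (second_excess \<phi> \<theta> / sin \<theta>) *\<^sub>R u" "vector_derivative \<gamma> (at t) = c *\<^sub>R u"
      using t meet_eq_support_point(2)[OF \<theta>, of \<phi>] u by simp_all
    moreover have "0 < second_excess \<phi> \<theta> / sin \<theta>" using pos s0 by simp
    ultimately show ?thesis unfolding tangent_direction_def using u by (metis norm_dir(2))
  qed
qed

lemma visual_angle_meet:
  assumes \<phi>: "0 \<le> \<phi>" "\<phi> < 2 * pi" and \<theta>: "0 < \<theta>" "\<theta> < pi"
  shows "visual_angle \<gamma> (meet \<phi> \<theta>) = pi - \<theta>"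
proof -
  have inner: "- perp \<phi> \<bullet> perp (\<phi> + \<theta>) = cos (pi - \<theta>)" "perp (\<phi> + \<theta>) \<bullet> - perp \<phi> = cos (pi - \<theta>)"
    by simp_all
  have arc: "arccos (cos (pi - \<theta>)) = pi - \<theta>" using \<theta> by (intro arccos_cos) auto
  have ne: "- perp \<phi> \<noteq> perp (\<phi> + \<theta>)"
  proof
    assume "- perp \<phi> = perp (\<phi> + \<theta>)"
    then have "cos (pi - \<theta>) = 1" using inner(1) by simp
    then have "pi - \<theta> = 0" using arc by simp
    then show False using \<theta> by simp
  qed
  show ?thesis
    unfolding visual_angle_def tangent_direction_meet[OF assms]
  proof (rule the_equality)
    show "\<exists>u v. u \<noteq> v \<and> (u = - perp \<phi> \<or> u = perp (\<phi> + \<theta>)) \<and> (v = - perp \<phi> \<or> v = perp (\<phi> + \<theta>)) \<and> pi - \<theta> = arccos (u \<bullet> v)"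
      using ne inner arc by metis
    fix \<omega> assume "\<exists>u v. u \<noteq> v \<and> (u = - perp \<phi> \<or> u = perp (\<phi> + \<theta>)) \<and> (v = - perp \<phi> \<or> v = perp (\<phi> + \<theta>)) \<and> \<omega> = arccos (u \<bullet> v)"
    then show "\<omega> = pi - \<theta>" using inner arc by metis
  qed
qed

end

section \<open>The change of variables\<close>

text \<open>
  Fubini for \<open>\<real>\<^sup>2\<close> as a space of vectors, transferred from the product \<open>\<real> \<times> \<real>\<close> along the coordinate bijection, which
  preserves the content of boxes.
\<close>

lemma integral_real2_box_iterated:
  fixes f :: "real^2 \<Rightarrow> real"
  assumes f: "continuous_on (cbox (vector [a, c]) (vector [b, d])) f"
  shows "integral (cbox (vector [a, c]) (vector [b, d])) f =
    integral {c..d} (\<lambda>y. integral {a..b} (\<lambda>x. f (vector [x, y])))"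
proof -
  define g where "g = (\<lambda>z::real\<times>real. vector [snd z, fst z] :: real^2)"
  define h where "h = (\<lambda>v::real^2. (v $ 2, v $ 1))"
  have hg: "h (g z) = z" and gh: "g (h v) = v" for z v
    by (simp_all add: g_def h_def vec2_eq_iff)
  have g_img: "g ` cbox u v = cbox (g u) (g v)" for u v
  proof -
    have "x \<in> g ` cbox u v \<longleftrightarrow> h x \<in> cbox u v" for x
      using hg gh by (metis image_iff)
    moreover have "h x \<in> cbox u v \<longleftrightarrow> x \<in> cbox (g u) (g v)" for x
      by (cases u; cases v) (auto simp: g_def h_def mem_box_cart forall_2 cbox_Pair_eq)
    ultimately show ?thesis by blast
  qed
  have h_img: "h ` cbox u v = cbox (h u) (h v)" for u v
  proof -
    have "h ` cbox u v = h ` g ` cbox (h u) (h v)" by (simp add: g_img gh)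
    also have "\<dots> = cbox (h u) (h v)" by (simp add: image_image hg)
    finally show ?thesis .
  qed
  have content: "Henstock_Kurzweil_Integration.content (g ` cbox u v) = 1 * Henstock_Kurzweil_Integration.content (cbox u v)" for u v
  proof (cases "cbox u v = {}")
    case False
    obtain u1 u2 v1 v2 where uv: "u = (u1, u2)" "v = (v1, v2)" by (cases u; cases v)
    have ne: "cbox (g u) (g v) \<noteq> {}" using False g_img[of u v] by auto
    have le: "u1 \<le> v1" "u2 \<le> v2" using False by (auto simp: uv cbox_Pair_eq)
    have "Henstock_Kurzweil_Integration.content (cbox (g u) (g v)) = (v2 - u2) * (v1 - u1)"
      unfolding content_cbox_cart[OF ne] by (simp add: UNIV_2 g_def uv)
    then show ?thesis using le by (simp add: g_img uv content_Pair)
  qed simp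
  have contg: "continuous_on S g" for S
  proof -
    have "g = (\<lambda>z. snd z *\<^sub>R axis 1 1 + fst z *\<^sub>R axis 2 1)"
      by (auto simp: g_def vec2_eq_iff axis_def)
    then show ?thesis by (simp only:) (intro continuous_intros)
  qed
  have isg: "isCont g z" for z
    using contg[of UNIV] continuous_on_eq_continuous_at[OF open_UNIV, of g] by blast
  let ?A = "vector [a, c] :: real^2" and ?B = "vector [b, d] :: real^2"
  have hAB: "h ?A = (c, a)" "h ?B = (d, b)" by (simp_all add: h_def)
  have "(f has_integral integral (cbox ?A ?B) f) (cbox ?A ?B)"
    by (intro integrable_integral integrable_continuous f)
  moreover have "\<exists>w z. g ` cbox u v = cbox w z" for u v using g_img by blast
  moreover have "\<exists>w z. h ` cbox u v = cbox w z" for u v using h_img by blast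
  ultimately have "((\<lambda>z. f (g z)) has_integral (1 / 1) *\<^sub>R integral (cbox ?A ?B) f) (h ` cbox ?A ?B)"
    by (intro has_integral_twiddle hg gh isg content) auto
  then have "((\<lambda>z. f (g z)) has_integral integral (cbox ?A ?B) f) (cbox (c, a) (d, b))"
    unfolding h_img hAB by simp
  then have "integral (cbox ?A ?B) f = integral (cbox (c, a) (d, b)) (\<lambda>z. f (g z))"
    by (simp add: integral_unique)
  also have "\<dots> = integral (cbox c d) (\<lambda>y. integral (cbox a b) (\<lambda>x. f (g (y, x))))"
  proof (rule integral_prod_continuous)
    have "g ` cbox (c, a) (d, b) = cbox ?A ?B"
      unfolding g_img by (simp add: g_def)
    then show "continuous_on (cbox (c, a) (d, b)) (\<lambda>z. f (g z))"
      using continuous_on_compose2[OF f contg] by simp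
  qed
  finally show ?thesis by (simp add: g_def)
qed

lemma has_absolute_integral_change_of_variables_real:
  fixes f :: "real^'m::{finite,wellorder} \<Rightarrow> real" and g :: "real^'m::_ \<Rightarrow> real^'m::_"
  assumes "S \<in> sets lebesgue"
    and "\<And>x. x \<in> S \<Longrightarrow> (g has_derivative g' x) (at x within S)"
    and "inj_on g S"
  shows "(\<lambda>x. \<bar>det (matrix (g' x))\<bar> * f (g x)) absolutely_integrable_on S \<and>
      integral S (\<lambda>x. \<bar>det (matrix (g' x))\<bar> * f (g x)) = b
    \<longleftrightarrow> f absolutely_integrable_on (g ` S) \<and> integral (g ` S) f = b"
proof -
  have "(\<lambda>x. \<bar>det (matrix (g' x))\<bar> *\<^sub>R vec (f (g x)) :: real^1) absolutely_integrable_on S \<and>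
      integral S (\<lambda>x. \<bar>det (matrix (g' x))\<bar> *\<^sub>R vec (f (g x))) = (vec b :: real^1)
    \<longleftrightarrow> (\<lambda>x. vec (f x) :: real^1) absolutely_integrable_on (g ` S) \<and>
      integral (g ` S) (\<lambda>x. vec (f x)) = (vec b :: real^1)"
    by (intro has_absolute_integral_change_of_variables assms)
  then show ?thesis by (simp add: absolutely_integrable_on_1_iff integral_on_1_eq)
qed

lemma dir_has_vector_derivative: "(dir has_vector_derivative perp \<phi>) (at \<phi>)"
  and perp_has_vector_derivative: "(perp has_vector_derivative - dir \<phi>) (at \<phi>)"
proof -
  have "((\<lambda>\<phi>. cos \<phi> *\<^sub>R (axis 1 1 :: real^2) + sin \<phi> *\<^sub>R axis 2 1) has_vector_derivative
      (- sin \<phi>) *\<^sub>R axis 1 1 + cos \<phi> *\<^sub>R axis 2 1) (at \<phi>)"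
    by (auto intro!: derivative_eq_intros)
  moreover have "(\<lambda>\<phi>. cos \<phi> *\<^sub>R (axis 1 1 :: real^2) + sin \<phi> *\<^sub>R axis 2 1) = dir"
      "(- sin \<phi>) *\<^sub>R axis 1 1 + cos \<phi> *\<^sub>R axis 2 1 = perp \<phi>"
    by (auto simp: vec2_eq_iff axis_def)
  ultimately show "(dir has_vector_derivative perp \<phi>) (at \<phi>)" by simp
  have "((\<lambda>\<phi>. (- sin \<phi>) *\<^sub>R (axis 1 1 :: real^2) + cos \<phi> *\<^sub>R axis 2 1) has_vector_derivative
      (- cos \<phi>) *\<^sub>R axis 1 1 + (- sin \<phi>) *\<^sub>R axis 2 1) (at \<phi>)"
    by (auto intro!: derivative_eq_intros)
  moreover have "(\<lambda>\<phi>. (- sin \<phi>) *\<^sub>R (axis 1 1 :: real^2) + cos \<phi> *\<^sub>R axis 2 1) = perp"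
      "(- cos \<phi>) *\<^sub>R axis 1 1 + (- sin \<phi>) *\<^sub>R axis 2 1 = - dir \<phi>"
    by (auto simp: vec2_eq_iff axis_def)
  ultimately show "(perp has_vector_derivative - dir \<phi>) (at \<phi>)" by simp
qed

lemma has_derivative_dir [derivative_intros]:
  assumes "(f has_derivative f') (at x within S)"
  shows "((\<lambda>x. dir (f x)) has_derivative (\<lambda>h. f' h *\<^sub>R perp (f x))) (at x within S)"
    and "((\<lambda>x. perp (f x)) has_derivative (\<lambda>h. f' h *\<^sub>R - dir (f x))) (at x within S)"
  using has_derivative_compose[OF assms] dir_has_vector_derivative[of "f x"]
    perp_has_vector_derivative[of "f x"]
  unfolding has_vector_derivative_def by blast+

context smooth_oval
begin

lemma has_derivative_p [derivative_intros]:
  assumes "(f has_derivative f') (at x within S)"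
  shows "((\<lambda>x. p (f x)) has_derivative (\<lambda>h. dp (f x) * f' h)) (at x within S)"
  using has_derivative_compose[OF assms has_field_derivative_imp_has_derivative[OF p_deriv]] .

text \<open>
  Differentiating \<open>P \<bullet> dir \<phi> = p(\<phi>)\<close> and \<open>P \<bullet> dir (\<phi> + \<theta>) = p(\<phi> + \<theta>)\<close> shows that moving \<open>\<theta>\<close> slides \<open>P\<close> along the first
  line with speed \<open>T\<^sub>2 / sin \<theta>\<close>, and that moving \<open>\<phi>\<close> shifts \<open>P\<close> by \<open>- T\<^sub>1\<close> in the direction of the first normal. The
  determinant is therefore \<open>- T\<^sub>1 T\<^sub>2 / sin \<theta>\<close>.
\<close>

definition meet_deriv :: "real \<Rightarrow> real \<Rightarrow> real^2 \<Rightarrow> real^2" where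
  "meet_deriv \<phi> \<theta> h =
     (h $ 1) *\<^sub>R (- (first_excess \<phi> \<theta> / sin \<theta>) *\<^sub>R dir \<phi> +
        ((second_excess \<phi> \<theta> + first_excess \<phi> \<theta> * cos \<theta>) / (sin \<theta>)\<^sup>2) *\<^sub>R perp \<phi>)
     + (h $ 2) *\<^sub>R ((second_excess \<phi> \<theta> / (sin \<theta>)\<^sup>2) *\<^sub>R perp \<phi>)"

lemma det_meet_deriv:
  assumes "sin \<theta> \<noteq> 0"
  shows "det (matrix (meet_deriv \<phi> \<theta>)) = - (first_excess \<phi> \<theta> * second_excess \<phi> \<theta>) / sin \<theta> ^ 3"
proof -
  define T Y W where "T = first_excess \<phi> \<theta> / sin \<theta>"
    and "Y = (second_excess \<phi> \<theta> + first_excess \<phi> \<theta> * cos \<theta>) / (sin \<theta>)\<^sup>2"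
    and "W = second_excess \<phi> \<theta> / (sin \<theta>)\<^sup>2"
  have c2: "cos \<phi> * cos \<phi> = 1 - sin \<phi> * sin \<phi>"
    using sin_cos_squared_add[of \<phi>] by (simp add: power2_eq_square algebra_simps)
  have c3: "cos \<phi> * (cos \<phi> * y) = y - sin \<phi> * (sin \<phi> * y)" for y
    using c2 by (simp add: mult.assoc[symmetric] left_diff_distrib)
  have "det (matrix (meet_deriv \<phi> \<theta>)) = - T * W"
    unfolding det_2 matrix_def meet_deriv_def T_def[symmetric] Y_def[symmetric] W_def[symmetric]
    by (simp add: axis_def algebra_simps c2 c3)
  also have "\<dots> = - (first_excess \<phi> \<theta> * second_excess \<phi> \<theta>) / sin \<theta> ^ 3"
    using assms by (simp add: T_def W_def power2_eq_square power3_eq_cube)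
  finally show ?thesis .
qed

lemma meet_has_derivative:
  fixes x :: "real^2"
  assumes s: "sin (x $ 2) \<noteq> 0"
  shows "((\<lambda>x. meet (x $ 1) (x $ 2)) has_derivative meet_deriv (x $ 1) (x $ 2)) (at x within S)"
proof -
  let ?q = "p (x $ 1 + x $ 2)" and ?dq = "dp (x $ 1 + x $ 2)" and ?p = "p (x $ 1)" and ?dp = "dp (x $ 1)"
  let ?s = "sin (x $ 2)" and ?c = "cos (x $ 2)"
  have nth [derivative_intros]: "((\<lambda>x::real^2. x $ i) has_derivative (\<lambda>h. h $ i)) (at x within S)" for i
    by (rule bounded_linear_imp_has_derivative[OF bounded_linear_vec_nth])
  \<comment> \<open>The derivative of the coordinate of the meeting point along the first line.\<close>
  define \<tau>' where "\<tau>' = (\<lambda>h::real^2. ((?dq * (h $ 1 + h $ 2) - (?dp * h $ 1 * ?c - ?p * ?s * h $ 2)) * ?s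
       - (?q - ?p * ?c) * (?c * h $ 2)) / (?s * ?s))"
  have tau: "((\<lambda>x::real^2. (p (x $ 1 + x $ 2) - p (x $ 1) * cos (x $ 2)) / sin (x $ 2)) has_derivative \<tau>') (at x within S)"
    unfolding \<tau>'_def
    by (rule derivative_eq_intros refl s | simp)+ (simp add: fun_eq_iff algebra_simps)
  have "((\<lambda>x. meet (x $ 1) (x $ 2)) has_derivative
      (\<lambda>h. (?p *\<^sub>R (h $ 1 *\<^sub>R perp (x $ 1)) + (?dp * h $ 1) *\<^sub>R dir (x $ 1)) +
        (((?q - ?p * ?c) / ?s) *\<^sub>R (h $ 1 *\<^sub>R - dir (x $ 1)) + \<tau>' h *\<^sub>R perp (x $ 1)))) (at x within S)"
    unfolding meet_def
    by (intro has_derivative_add has_derivative_scaleR has_derivative_p has_derivative_dir nth tau)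
  moreover have "(\<lambda>h. (?p *\<^sub>R (h $ 1 *\<^sub>R perp (x $ 1)) + (?dp * h $ 1) *\<^sub>R dir (x $ 1)) +
        (((?q - ?p * ?c) / ?s) *\<^sub>R (h $ 1 *\<^sub>R - dir (x $ 1)) + \<tau>' h *\<^sub>R perp (x $ 1))) = meet_deriv (x $ 1) (x $ 2)"
  proof
    fix h :: "real^2"
    have s2: "sin (x $ 2) * sin (x $ 2) = 1 - ?c * ?c"
      using sin_cos_squared_add[of "x $ 2"] by (simp add: power2_eq_square algebra_simps)
    have d: "?dp - (?q - ?p * ?c) / ?s = - (first_excess (x $ 1) (x $ 2) / ?s)"
      using s by (simp add: first_excess_def field_simps)
    have t: "?p * h $ 1 + \<tau>' h = h $ 1 * ((second_excess (x $ 1) (x $ 2) + first_excess (x $ 1) (x $ 2) * ?c) / ?s\<^sup>2)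
        + h $ 2 * (second_excess (x $ 1) (x $ 2) / ?s\<^sup>2)"
    proof -
      have "?s\<^sup>2 * (?p * h $ 1 + \<tau>' h) = ?p * h $ 1 * (?s * ?s) + ((?dq * (h $ 1 + h $ 2) - (?dp * h $ 1 * ?c - ?p * ?s * h $ 2)) * ?s
       - (?q - ?p * ?c) * (?c * h $ 2))"
        using s by (simp add: \<tau>'_def power2_eq_square distrib_left)
      also have "\<dots> = h $ 1 * (second_excess (x $ 1) (x $ 2) + first_excess (x $ 1) (x $ 2) * ?c) + h $ 2 * second_excess (x $ 1) (x $ 2)"
      proof -
        have "?p * ?s * h $ 2 * ?s = ?p * h $ 2 * (?s * ?s)" by simp
        then show ?thesis unfolding first_excess_def second_excess_def
          by (simp add: left_diff_distrib right_diff_distrib distrib_left distrib_right s2 mult_ac)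
      qed
      finally show ?thesis using s by (simp add: field_simps)
    qed
    have "(?p *\<^sub>R (h $ 1 *\<^sub>R perp (x $ 1)) + (?dp * h $ 1) *\<^sub>R dir (x $ 1)) +
        (((?q - ?p * ?c) / ?s) *\<^sub>R (h $ 1 *\<^sub>R - dir (x $ 1)) + \<tau>' h *\<^sub>R perp (x $ 1)) =
        (h $ 1 * (?dp - (?q - ?p * ?c) / ?s)) *\<^sub>R dir (x $ 1) + (?p * h $ 1 + \<tau>' h) *\<^sub>R perp (x $ 1)"
      by (simp add: scaleR_left_distrib right_diff_distrib scaleR_left_diff_distrib mult.commute)
    also have "\<dots> = meet_deriv (x $ 1) (x $ 2) h"
      unfolding d t meet_deriv_def
      by (simp add: scaleR_left_distrib scaleR_right_distrib scaleR_right_diff_distrib)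
    finally show "(?p *\<^sub>R (h $ 1 *\<^sub>R perp (x $ 1)) + (?dp * h $ 1) *\<^sub>R dir (x $ 1)) +
        (((?q - ?p * ?c) / ?s) *\<^sub>R (h $ 1 *\<^sub>R - dir (x $ 1)) + \<tau>' h *\<^sub>R perp (x $ 1)) = meet_deriv (x $ 1) (x $ 2) h" .
  qed
  ultimately show ?thesis by simp
qed

text \<open>
  Half-open in \<open>\<phi>\<close>, so that the parametrisation of the exterior is bijective.
\<close>

definition line_pairs :: "(real^2) set" where
  "line_pairs = {x. 0 \<le> x $ 1 \<and> x $ 1 < 2 * pi \<and> 0 < x $ 2 \<and> x $ 2 < pi}"

lemma line_pairs_measurable: "line_pairs \<in> sets lebesgue"
proof -
  have "line_pairs = {x. 0 \<le> x $ 1} \<inter> ({x. x $ 1 < 2 * pi} \<inter> ({x. 0 < x $ 2} \<inter> {x. x $ 2 < pi}))"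
    by (auto simp: line_pairs_def)
  moreover have "closed {x::real^2. 0 \<le> x $ 1}" by (intro closed_Collect_le continuous_intros)
  moreover have "open {x::real^2. x $ 1 < 2 * pi}" "open {x::real^2. 0 < x $ 2}" "open {x::real^2. x $ 2 < pi}"
    by (intro open_Collect_less continuous_intros)+
  ultimately have "line_pairs \<in> sets borel" by (metis borel_closed borel_open sets.Int)
  then show ?thesis by (simp add: sets_completionI_sets)
qed

lemma meet_image: "(\<lambda>x. meet (x $ 1) (x $ 2)) ` line_pairs = - K"
proof
  show "(\<lambda>x. meet (x $ 1) (x $ 2)) ` line_pairs \<subseteq> - K"
    using meet_notin_K by (auto simp: line_pairs_def)
  show "- K \<subseteq> (\<lambda>x. meet (x $ 1) (x $ 2)) ` line_pairs"
  proof
    fix P assume "P \<in> - K"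
    then obtain \<phi> \<theta> where *: "0 \<le> \<phi>" "\<phi> < 2 * pi" "0 < \<theta>" "\<theta> < pi" "P = meet \<phi> \<theta>"
      using notin_K_imp_meet by blast
    then show "P \<in> (\<lambda>x. meet (x $ 1) (x $ 2)) ` line_pairs"
      by (intro image_eqI[of _ _ "vector [\<phi>, \<theta>]"]) (auto simp: line_pairs_def)
  qed
qed

lemma inj_on_meet: "inj_on (\<lambda>x. meet (x $ 1) (x $ 2)) line_pairs"
proof (rule inj_onI)
  fix x y assume *: "x \<in> line_pairs" "y \<in> line_pairs" "meet (x $ 1) (x $ 2) = meet (y $ 1) (y $ 2)"
  then show "x = y" using meet_inj[OF *(3)] by (auto simp: line_pairs_def vec2_eq_iff)
qed

text \<open>
  The Jacobian \<open>T\<^sub>1 T\<^sub>2 / sin \<theta>\<close> times \<open>sin\<^sup>m \<theta>\<close> extends continuously to the closed box. This gives absolute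
  integrability over the unbounded exterior.
\<close>

lemma visual_angle_integral:
  assumes m: "m \<ge> 3"
  shows "(\<lambda>P. sin (visual_angle \<gamma> P) ^ m) absolutely_integrable_on (- K)"
    and "integral (- K) (\<lambda>P. sin (visual_angle \<gamma> P) ^ m) =
      integral {0..pi} (\<lambda>\<theta>. integral {0..2*pi} (\<lambda>\<phi>. sin \<theta> ^ (m - 3) * tangent_product \<phi> \<theta>))"
proof -
  let ?F = "\<lambda>x::real^2. sin (x $ 2) ^ (m - 3) * tangent_product (x $ 1) (x $ 2)"
  let ?B = "cbox (vector [0, 0]) (vector [2 * pi, pi]) :: (real^2) set"
  let ?g = "\<lambda>x::real^2. meet (x $ 1) (x $ 2)" and ?g' = "\<lambda>x::real^2. meet_deriv (x $ 1) (x $ 2)"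
  let ?f = "\<lambda>P. sin (visual_angle \<gamma> P) ^ m"
  have cont: "continuous_on ?B ?F"
    unfolding tangent_product_def by (intro continuous_intros)
  have sub: "line_pairs \<subseteq> ?B" "?B - line_pairs \<subseteq> ?B - box (vector [0, 0]) (vector [2 * pi, pi])"
    by (auto simp: line_pairs_def mem_box_cart forall_2)
  have absF: "?F absolutely_integrable_on line_pairs"
    using absolutely_integrable_continuous[OF cont] line_pairs_measurable sub(1) by (rule set_integrable_subset)
  have intF: "integral line_pairs ?F = integral ?B ?F"
    by (rule integral_subset_negligible[OF sub(1) negligible_subset[OF negligible_frontier_interval sub(2)]])
  have jac: "\<bar>det (matrix (?g' x))\<bar> * ?f (?g x) = ?F x" if "x \<in> line_pairs" for x
  proof -
    let ?s = "sin (x $ 2)"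
    from that have x: "0 \<le> x $ 1" "x $ 1 < 2 * pi" "0 < x $ 2" "x $ 2 < pi" by (auto simp: line_pairs_def)
    have s: "0 < ?s" using x by (intro sin_gt_zero)
    have "?f (?g x) = ?s ^ (m - 3 + 3)" using visual_angle_meet[OF x] m by simp
    then have f: "?f (?g x) = ?s ^ (m - 3) * ?s ^ 3" by (simp only: power_add)
    have prod: "tangent_product (x $ 1) (x $ 2) = first_excess (x $ 1) (x $ 2) * second_excess (x $ 1) (x $ 2)"
      by (simp add: tangent_product_def first_excess_def second_excess_def)
    have "\<bar>det (matrix (?g' x))\<bar> = tangent_product (x $ 1) (x $ 2) / ?s ^ 3"
      using s excess_pos[OF x(3,4), of "x $ 1"] unfolding det_meet_deriv[OF less_imp_neq[OF s, symmetric]] prod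
      by (simp add: abs_mult)
    then show ?thesis unfolding f using s by simp
  qed
  have "((\<lambda>x. \<bar>det (matrix (?g' x))\<bar> * ?f (?g x)) absolutely_integrable_on line_pairs \<and>
      integral line_pairs (\<lambda>x. \<bar>det (matrix (?g' x))\<bar> * ?f (?g x)) = integral ?B ?F)
    \<longleftrightarrow> (?f absolutely_integrable_on ?g ` line_pairs \<and> integral (?g ` line_pairs) ?f = integral ?B ?F)"
  proof (rule has_absolute_integral_change_of_variables_real[OF line_pairs_measurable _ inj_on_meet])
    fix x assume "x \<in> line_pairs"
    then have "sin (x $ 2) \<noteq> 0" using sin_gt_zero[of "x $ 2"] by (auto simp: line_pairs_def)
    then show "(?g has_derivative ?g' x) (at x within line_pairs)" by (rule meet_has_derivative)
  qed
  moreover have "(\<lambda>x. \<bar>det (matrix (?g' x))\<bar> * ?f (?g x)) absolutely_integrable_on line_pairs"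
  proof -
    have "set_integrable lebesgue line_pairs (\<lambda>x. \<bar>det (matrix (?g' x))\<bar> * ?f (?g x)) = set_integrable lebesgue line_pairs ?F"
      by (rule set_integrable_cong[OF refl refl]) (rule jac)
    then show ?thesis using absF by (simp only:)
  qed
  moreover have "integral line_pairs (\<lambda>x. \<bar>det (matrix (?g' x))\<bar> * ?f (?g x)) = integral ?B ?F"
    unfolding intF[symmetric] by (rule integral_cong[OF jac])
  ultimately have *: "?f absolutely_integrable_on - K \<and> integral (- K) ?f = integral ?B ?F"
    unfolding meet_image by blast
  then show "?f absolutely_integrable_on - K" by blast
  show "integral (- K) ?f = integral {0..pi} (\<lambda>\<theta>. integral {0..2*pi} (\<lambda>\<phi>. sin \<theta> ^ (m - 3) * tangent_product \<phi> \<theta>))"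
    using * integral_real2_box_iterated[OF cont] by simp
qed

end

section \<open>Cauchy's formula for the length\<close>

text \<open>
  The angle is obtained by integrating the angular velocity \<open>\<omega>\<close> of \<open>g\<close>. In the frame turning with \<open>\<psi>\<close> the vector \<open>g\<close> can only
  change its length, so its normalised component along \<open>dir \<psi>\<close> stays zero.
\<close>

lemma polar_angle_lift:
  fixes g g' :: "real \<Rightarrow> real^2"
  assumes g: "\<And>t. (g has_vector_derivative g' t) (at t)" and cont: "continuous_on UNIV g'"
    and nz: "\<And>t. g t \<noteq> 0" and init: "g 0 \<bullet> dir \<psi>0 = 0"
  obtains \<psi> \<psi>' where "\<And>t. t \<in> {0..1} \<Longrightarrow> (\<psi> has_real_derivative \<psi>' t) (at t within {0..1})"
    "continuous_on {0..1} \<psi>'" "\<psi> 0 = \<psi>0" "\<And>t. t \<in> {0..1} \<Longrightarrow> g t \<bullet> dir (\<psi> t) = 0"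
proof -
  define N where "N t = (g t $ 1)\<^sup>2 + (g t $ 2)\<^sup>2" for t
  define \<omega> where "\<omega> t = (g t $ 1 * g' t $ 2 - g t $ 2 * g' t $ 1) / N t" for t
  have N0: "N t \<noteq> 0" for t
    using nz[of t] by (simp add: N_def vec2_eq_iff sum_power2_eq_zero_iff)
  have gd: "((\<lambda>t. g t $ i) has_real_derivative g' t $ i) (at t within S)" for i t S
    using bounded_linear.has_vector_derivative[OF bounded_linear_vec_nth g]
    by (simp add: has_real_derivative_iff_has_vector_derivative has_vector_derivative_at_within)
  have gc: "continuous_on S g" for S
    using g by (meson continuous_at_imp_continuous_on has_vector_derivative_continuous)
  have g'c: "continuous_on S g'" for S using cont continuous_on_subset by blast
  have \<omega>c: "continuous_on {0..1} \<omega>"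
    unfolding \<omega>_def N_def using N0 by (intro continuous_intros gc g'c) (auto simp: N_def)
  define \<psi> where "\<psi> t = \<psi>0 + integral {0..t} \<omega>" for t
  have \<psi>d: "(\<psi> has_real_derivative \<omega> t) (at t within {0..1})" if "t \<in> {0..1}" for t
  proof -
    have "((\<lambda>u. integral {0..u} \<omega>) has_vector_derivative \<omega> t) (at t within {0..1})"
      by (rule integral_has_vector_derivative[OF \<omega>c that])
    then have "((\<lambda>u. \<psi>0 + integral {0..u} \<omega>) has_vector_derivative 0 + \<omega> t) (at t within {0..1})"
      by (intro derivative_intros)
    then show ?thesis unfolding \<psi>_def[abs_def] by (simp add: has_real_derivative_iff_has_vector_derivative)
  qed
  \<comment> \<open>With \<open>b = g \<bullet> dir \<psi>\<close> and \<open>N = \<bar>g\<bar>\<^sup>2\<close>, both \<open>b\<^sup>2\<close> and \<open>N\<close> solve \<open>y' = \<lambda> y\<close> with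
    \<open>\<lambda> = 2 (g \<bullet> g') / N\<close>, so the quotient \<open>F\<close> is constant.\<close>
  define b where "b t = g t $ 1 * cos (\<psi> t) + g t $ 2 * sin (\<psi> t)" for t
  define F where "F t = (b t)\<^sup>2 / N t" for t
  have Fd: "(F has_real_derivative 0) (at t within {0..1})" if t: "t \<in> {0..1}" for t
  proof -
    let ?x = "g t $ 1" and ?y = "g t $ 2" and ?x' = "g' t $ 1" and ?y' = "g' t $ 2"
    let ?c = "cos (\<psi> t)" and ?s = "sin (\<psi> t)"
    define b' where "b' = ?x' * ?c - ?x * ?s * \<omega> t + (?y' * ?s + ?y * ?c * \<omega> t)"
    have bd: "(b has_real_derivative b') (at t within {0..1})"
      unfolding b_def[abs_def] b'_def
      by (rule derivative_eq_intros gd \<psi>d[OF t] refl | simp)+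
    have Nd: "(N has_real_derivative 2 * (?x * ?x' + ?y * ?y')) (at t within {0..1})"
      unfolding N_def[abs_def] by (rule derivative_eq_intros gd refl | simp)+
    have "(F has_real_derivative ((2 * b t * b') * N t - (b t)\<^sup>2 * (2 * (?x * ?x' + ?y * ?y'))) / (N t * N t)) (at t within {0..1})"
      unfolding F_def[abs_def] using N0[of t]
      by (auto intro!: derivative_eq_intros bd Nd)
    moreover have "b' * N t = b t * (?x * ?x' + ?y * ?y')"
    proof -
      have \<omega>N: "\<omega> t * N t = ?x * ?y' - ?y * ?x'" using N0[of t] by (simp add: \<omega>_def)
      have "b' * N t = (?x' * ?c + ?y' * ?s) * N t + (?y * ?c - ?x * ?s) * (\<omega> t * N t)"
        by (simp add: b'_def algebra_simps)
      also have "\<dots> = b t * (?x * ?x' + ?y * ?y')"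
        unfolding \<omega>N by (simp add: N_def b_def power2_eq_square algebra_simps)
      finally show ?thesis .
    qed
    then have "(2 * b t * b') * N t - (b t)\<^sup>2 * (2 * (?x * ?x' + ?y * ?y')) = 0"
      by (simp add: power2_eq_square mult.assoc)
    ultimately show ?thesis by simp
  qed
  have "F t = 0" if "t \<in> {0..1}" for t
  proof -
    have "F t = F 0"
      using has_field_derivative_zero_constant[of "{0..1}" F] Fd that
      by (metis atLeastAtMost_iff convex_real_interval(5) order_refl zero_le_one)
    also have "F 0 = 0" using init by (simp add: F_def b_def \<psi>_def inner_real2)
    finally show ?thesis .
  qed
  then have "g t \<bullet> dir (\<psi> t) = 0" if "t \<in> {0..1}" for t
    using that N0[of t] by (auto simp: F_def b_def inner_real2)
  moreover have "\<psi> 0 = \<psi>0" by (simp add: \<psi>_def)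
  ultimately show thesis using that[of \<psi> \<omega>] \<psi>d \<omega>c by blast
qed

context smooth_oval
begin

text \<open>
  The radius of curvature \<open>p + p''\<close>, integrated over one full turn in either direction.
\<close>

lemma curvature_radius_integral:
  assumes a: "0 \<le> a" "a \<le> 2 * pi"
  shows "integral {a..a + 2 * pi} (\<lambda>x. p x + ddp x) = integral {0..2*pi} p"
    and "integral {a - 2 * pi..a} (\<lambda>x. p x + ddp x) = integral {0..2*pi} p"
proof -
  let ?r = "\<lambda>x. p x + ddp x"
  have ddp_per: "ddp (x + 2 * pi) = ddp x" for x
  proof -
    have "((\<lambda>x. dp (x + 2 * pi)) has_real_derivative ddp (x + 2 * pi)) (at x)"
      using DERIV_shift[of dp "ddp (x + 2 * pi)" x "2 * pi"] dp_deriv by simp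
    then show ?thesis unfolding dp_periodic by (rule DERIV_unique) (rule dp_deriv)
  qed
  have per: "?r (x + 2 * pi) = ?r x" for x by (simp add: p_periodic ddp_per)
  have cont: "continuous_on S ?r" for S by (intro continuous_intros)
  have sh: "integral {x..y} (\<lambda>t. ?r (t + c)) = integral {x + c..y + c} ?r" for x y c
    using integral_shift[of x c y ?r] cont by (simp add: o_def)
  have ddp0: "integral {0..2*pi} ddp = 0"
  proof -
    have "(ddp has_integral dp (2*pi) - dp 0) {0..2*pi}"
      by (intro fundamental_theorem_of_calculus)
         (auto simp: has_real_derivative_iff_has_vector_derivative[symmetric] intro: DERIV_subset[OF dp_deriv])
    then show ?thesis using dp_periodic[of 0] by (simp add: integral_unique)
  qed
  have base: "integral {0..2*pi} ?r = integral {0..2*pi} p"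
    using ddp0 by (subst integral_add) (auto intro!: integrable_continuous_interval continuous_intros)
  have 1: "integral {0..2*pi} (\<lambda>x. ?r (x + a)) = integral {0..2*pi} ?r"
    by (rule integral_periodic_shift[OF cont per a])
  then show "integral {a..a + 2 * pi} ?r = integral {0..2*pi} p"
    using sh[of 0 "2*pi" a] base by (simp add: add.commute)
  have "integral {0..2*pi} (\<lambda>x. ?r (x + (a - 2 * pi))) = integral {0..2*pi} (\<lambda>x. ?r (x + a))"
  proof (rule integral_cong)
    fix x show "?r (x + (a - 2 * pi)) = ?r (x + a)"
      using per[of "x + (a - 2 * pi)"] by (simp add: algebra_simps)
  qed
  then show "integral {a - 2 * pi..a} ?r = integral {0..2*pi} p"
    using sh[of 0 "2*pi" "a - 2 * pi"] base 1 by simp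
qed

lemma integral_p_nonneg: "0 \<le> integral {0..2*pi} p"
proof -
  have "integral {0..2*pi} (\<lambda>x. p x + p (x + pi)) = integral {0..2*pi} p + integral {0..2*pi} (\<lambda>x. p (x + pi))"
    by (intro integral_add integrable_continuous_interval continuous_intros)
  also have "integral {0..2*pi} (\<lambda>x. p (x + pi)) = integral {0..2*pi} p"
    by (rule integral_periodic_shift[OF p_cont p_periodic]) auto
  moreover have "0 \<le> integral {0..2*pi} (\<lambda>x. p x + p (x + pi))"
    by (intro integral_nonneg integrable_continuous_interval continuous_intros) (use width_pos in \<open>auto intro: less_imp_le\<close>)
  ultimately show ?thesis by simp
qed

lemma support_point_has_vector_derivative:
  "(support_point has_vector_derivative (p \<phi> + ddp \<phi>) *\<^sub>R perp \<phi>) (at \<phi>)"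
proof -
  have d: "(p has_vector_derivative dp \<phi>) (at \<phi>)" "(dp has_vector_derivative ddp \<phi>) (at \<phi>)"
    using p_deriv dp_deriv by (simp_all add: has_real_derivative_iff_has_vector_derivative[symmetric])
  have "(support_point has_vector_derivative (p \<phi> *\<^sub>R perp \<phi> + dp \<phi> *\<^sub>R dir \<phi>)
      + (dp \<phi> *\<^sub>R - dir \<phi> + ddp \<phi> *\<^sub>R perp \<phi>)) (at \<phi>)"
    unfolding support_point_def[abs_def]
    by (intro has_vector_derivative_add has_vector_derivative_scaleR p_deriv dp_deriv
        dir_has_vector_derivative perp_has_vector_derivative)
  then show ?thesis by (simp add: scaleR_left_distrib)
qed

text \<open>
  Let \<open>\<psi>(t)\<close> be the angle of the outer normal at \<open>\<gamma> t\<close>. Then \<open>\<gamma> = support_point \<circ> \<psi>\<close>, so the speed of \<open>\<gamma>\<close> is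
  \<open>\<bar>\<psi>' (p + p'')(\<psi>)\<bar>\<close>. It never vanishes, so \<open>\<psi>' (p + p'')(\<psi>)\<close> has constant sign, and the length is up to sign
  the integral of \<open>p + p''\<close> from \<open>\<psi> 0\<close> to \<open>\<psi> 1\<close>. As \<open>\<gamma>\<close> is closed and simple, \<open>\<psi>\<close> turns
  by exactly \<open>2\<pi>\<close>, in one direction or the other.
\<close>

lemma curve_length_eq: "curve_length \<gamma> = integral {0..2*pi} p"
proof -
  obtain g g2 where g: "\<And>t. (\<gamma> has_vector_derivative g t) (at t)"
      and g2: "\<And>t. (g has_vector_derivative g2 t) (at t)" "continuous_on UNIV g2"
    using C2_functionE boundary unfolding C2_boundary_def by metis
  have vd: "vector_derivative \<gamma> (at t) = g t" for t using g vector_derivative_at by blast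
  have g0: "g t \<noteq> 0" for t using \<gamma>_regular[of t] vd by simp
  have inj: "inj_on \<gamma> {0..<1}" and per: "\<gamma> 1 = \<gamma> 0"
    using boundary unfolding C2_boundary_def by (simp, metis add_0)
  have in_frontier: "\<gamma> t \<in> frontier K" for t using frontier_param by blast
  obtain \<psi>0 where \<psi>0: "0 \<le> \<psi>0" "\<psi>0 < 2 * pi" "\<gamma> 0 = support_point \<psi>0"
    using frontier_support[OF in_frontier[of 0]] by blast
  have "g 0 \<bullet> dir \<psi>0 = 0" using tangent_orthogonal[OF \<psi>0(3)] vd by simp
  then obtain \<psi> \<psi>' where
      \<psi>: "\<And>t. t \<in> {0..1} \<Longrightarrow> (\<psi> has_real_derivative \<psi>' t) (at t within {0..1})"
    and \<psi>'c: "continuous_on {0..1} \<psi>'" and \<psi>_0: "\<psi> 0 = \<psi>0"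
    and orth: "\<And>t. t \<in> {0..1} \<Longrightarrow> g t \<bullet> dir (\<psi> t) = 0"
    using polar_angle_lift[OF g2 g0] by metis
  have \<psi>c: "continuous_on {0..1} \<psi>"
    using \<psi> by (meson DERIV_continuous continuous_on_eq_continuous_within)
  have \<gamma>c: "continuous_on S \<gamma>" for S
    using g by (meson continuous_at_imp_continuous_on has_vector_derivative_continuous)
  have \<gamma>K: "\<gamma> t \<in> K" for t using in_frontier frontier_subset_K by blast
  have nonneg: "0 \<le> gap (\<gamma> t) x" for t x using inner_le_p[OF \<gamma>K] by (simp add: gap_def)
  have zero: "gap (\<gamma> t) (\<psi> t) = 0 \<or> gap (\<gamma> t) (\<psi> t + pi) = 0" if t: "t \<in> {0..1}" for t
  proof -
    obtain \<phi> where \<phi>: "\<gamma> t = support_point \<phi>" using frontier_support[OF in_frontier] by blast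
    have "g t \<bullet> dir \<phi> = 0" using tangent_orthogonal[OF \<phi>] vd by simp
    then have gt: "g t = (g t \<bullet> perp \<phi>) *\<^sub>R perp \<phi>" by (rule orthogonal_to_perp)
    then have "g t \<bullet> perp \<phi> \<noteq> 0" using g0[of t] by (metis scale_zero_left)
    moreover have "(g t \<bullet> perp \<phi>) * sin (\<psi> t - \<phi>) = 0"
      using orth[OF t] gt by (metis inner_dir_perp(4) inner_scaleR_left)
    ultimately have s: "sin (\<psi> t - \<phi>) = 0" by simp
    then have "cos (\<psi> t - \<phi>) = 1 \<or> cos (\<psi> t - \<phi>) = -1"
      using sin_zero_abs_cos_one[OF s] by linarith
    then show ?thesis
    proof
      assume c: "cos (\<psi> t - \<phi>) = 1"
      have "dir (\<phi> + (\<psi> t - \<phi>)) = dir \<phi>"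
        by (simp only: vec2_eq_iff dir_nth cos_add sin_add s c) simp
      then have "dir (\<psi> t) = dir \<phi>" by simp
      then have "gap (\<gamma> t) (\<psi> t) = gap (\<gamma> t) \<phi>" by (simp add: gap_def p_eq)
      then show ?thesis by (simp add: gap_def \<phi>)
    next
      assume c: "cos (\<psi> t - \<phi>) = -1"
      have "dir (\<phi> + (\<psi> t - \<phi>) + pi) = dir \<phi>"
        unfolding dir_add_pi by (simp only: vec2_eq_iff dir_nth vector_uminus_component cos_add sin_add s c) simp
      then have "dir (\<psi> t + pi) = dir \<phi>" by simp
      then have "gap (\<gamma> t) (\<psi> t + pi) = gap (\<gamma> t) \<phi>" by (simp only: gap_def p_eq)
      then show ?thesis by (simp add: gap_def \<phi>)
    qed
  qed
  have gap0: "gap (\<gamma> t) (\<psi> t) = 0" if t: "t \<in> {0..1}" for t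
  proof (rule ccontr)
    \<comment> \<open>At each time one of the two gaps vanishes and, by positive width, not both; hence \<open>D\<close> has no zero
      and keeps the sign that the choice of \<open>\<psi> 0\<close> gives it.\<close>
    define D where "D s = gap (\<gamma> s) (\<psi> s) - gap (\<gamma> s) (\<psi> s + pi)" for s
    assume "\<not> ?thesis"
    then have "D t > 0" using zero[OF t] nonneg[of t "\<psi> t"] by (auto simp: D_def less_le)
    moreover have "D 0 \<le> 0"
    proof -
      have "gap (\<gamma> 0) (\<psi> 0) = 0" by (simp add: gap_def \<psi>_0 \<psi>0(3))
      then show ?thesis using nonneg[of 0 "\<psi> 0 + pi"] unfolding D_def by linarith
    qed
    moreover have "continuous_on {0..t} D"
      unfolding D_def gap_def inner_real2 dir_nth
      using t by (intro continuous_intros continuous_on_subset[OF \<psi>c] \<gamma>c) auto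
    ultimately obtain s where "0 \<le> s" "s \<le> t" "D s = 0"
      using IVT'[of D 0 0 t] t by auto
    then show False using zero[of s] gap_opposite[of "\<gamma> s" "\<psi> s"] t by (auto simp: D_def)
  qed
  have \<gamma>\<psi>: "\<gamma> t = support_point (\<psi> t)" if "t \<in> {0..1}" for t
    using gap0[OF that] by (intro support_point_unique \<gamma>K) (simp add: gap_def)
  let ?r = "\<lambda>x. p x + ddp x"
  have g_eq: "g t = (\<psi>' t * ?r (\<psi> t)) *\<^sub>R perp (\<psi> t)" if t: "t \<in> {0..1}" for t
  proof -
    have "((support_point \<circ> \<psi>) has_vector_derivative \<psi>' t *\<^sub>R (?r (\<psi> t) *\<^sub>R perp (\<psi> t))) (at t within {0..1})"
      using \<psi>[OF t] support_point_has_vector_derivative[of "\<psi> t"]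
      by (intro vector_diff_chain_within)
         (auto simp: has_real_derivative_iff_has_vector_derivative intro: has_vector_derivative_at_within)
    then have "(\<gamma> has_vector_derivative \<psi>' t *\<^sub>R (?r (\<psi> t) *\<^sub>R perp (\<psi> t))) (at t within {0..1})"
      by (rule has_vector_derivative_transform[rotated 2]) (use t \<gamma>\<psi> in auto)
    moreover have "(\<gamma> has_vector_derivative g t) (at t within {0..1})"
      using g by (rule has_vector_derivative_at_within)
    ultimately show ?thesis
      using vector_derivative_unique_within_closed_interval[of 0 1 t] t by auto
  qed
  have speed_nz: "\<psi>' t * ?r (\<psi> t) \<noteq> 0" if "t \<in> {0..1}" for t
    using g_eq[OF that] g0[of t] by auto
  have speed_cont: "continuous_on {0..1} (\<lambda>t. \<psi>' t * ?r (\<psi> t))"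
    by (intro continuous_intros \<psi>'c \<psi>c)
  have speed: "norm (vector_derivative \<gamma> (at t)) = \<bar>\<psi>' t * ?r (\<psi> t)\<bar>" if "t \<in> {0..1}" for t
    unfolding vd g_eq[OF that] by simp
  have sign: "(\<forall>t\<in>{0..1}. \<psi>' t * ?r (\<psi> t) > 0) \<or> (\<forall>t\<in>{0..1}. \<psi>' t * ?r (\<psi> t) < 0)"
  proof (rule ccontr)
    let ?v = "\<lambda>t. \<psi>' t * ?r (\<psi> t)"
    assume "\<not> ?thesis"
    then obtain s t where st: "s \<in> {0..1}" "t \<in> {0..1}" "?v s < 0" "0 < ?v t"
      using speed_nz by (metis linorder_neqE_linordered_idom)
    have "connected (?v ` {0..1})"
      by (intro connected_continuous_image speed_cont) simp
    then have "0 \<in> ?v ` {0..1}"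
      using connectedD_interval[of "?v ` {0..1}" "?v s" "?v t" 0] st by auto
    then show False using speed_nz by auto
  qed
  define J where "J = integral {0..1} (\<lambda>t. \<psi>' t * ?r (\<psi> t))"
  have LJ: "curve_length \<gamma> = \<bar>J\<bar>"
  proof (rule disjE[OF sign])
    assume pos: "\<forall>t\<in>{0..1}. \<psi>' t * ?r (\<psi> t) > 0"
    have "0 \<le> J" unfolding J_def
      by (rule integral_nonneg) (use pos in \<open>auto intro!: integrable_continuous_interval speed_cont intro: less_imp_le\<close>)
    moreover have "curve_length \<gamma> = J" unfolding curve_length_def J_def
    proof (rule integral_cong)
      fix t :: real assume t: "t \<in> {0..1}"
      then have "0 < \<psi>' t * ?r (\<psi> t)" using pos by blast
      then show "norm (vector_derivative \<gamma> (at t)) = \<psi>' t * ?r (\<psi> t)"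
        unfolding speed[OF t] by (rule abs_of_pos)
    qed
    ultimately show ?thesis by simp
  next
    assume neg: "\<forall>t\<in>{0..1}. \<psi>' t * ?r (\<psi> t) < 0"
    have "curve_length \<gamma> = integral {0..1} (\<lambda>t. - (\<psi>' t * ?r (\<psi> t)))" unfolding curve_length_def
    proof (rule integral_cong)
      fix t :: real assume t: "t \<in> {0..1}"
      then have "\<psi>' t * ?r (\<psi> t) < 0" using neg by blast
      then show "norm (vector_derivative \<gamma> (at t)) = - (\<psi>' t * ?r (\<psi> t))"
        unfolding speed[OF t] by (rule abs_of_neg)
    qed
    also have "\<dots> = - J" by (simp add: J_def)
    finally have L: "curve_length \<gamma> = - J" .
    have "0 \<le> curve_length \<gamma>" unfolding L J_def integral_neg[symmetric]
      by (rule integral_nonneg) (use neg in \<open>auto intro!: integrable_continuous_interval continuous_intros \<psi>'c \<psi>c intro: less_imp_le\<close>)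
    then show ?thesis using L by simp
  qed
  have no_return: "t = 1" if t: "0 < t" "t \<le> 1" and "\<gamma> t = \<gamma> 0" for t
    using inj_onD[OF inj that(3)] t by force
  \<comment> \<open>The net turn is a nonzero multiple of \<open>2\<pi>\<close>; a larger multiple would make \<open>\<gamma>\<close> return early.\<close>
  have turn: "\<psi> 1 = \<psi>0 + 2 * pi \<or> \<psi> 1 = \<psi>0 - 2 * pi"
  proof -
    have "\<psi> 1 \<noteq> \<psi> 0"
    proof
      assume eq: "\<psi> 1 = \<psi> 0"
      obtain t where "t \<in> {0<..<1}" "\<psi> 1 - \<psi> 0 = \<psi>' t * (1 - 0)"
        using mvt_simple[of 0 1 \<psi> "\<lambda>t. (*) (\<psi>' t)"] \<psi> by (auto simp: has_field_derivative_def)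
      then show False using eq speed_nz[of t] by auto
    qed
    have eq: "support_point (\<psi> 0) = support_point (\<psi> 1)" using \<gamma>\<psi>[of 0] \<gamma>\<psi>[of 1] per by simp
    have "cos (\<psi> 1 - \<psi> 0) = 1"
      using support_point_eq_imp[OF eq] sin_zero_abs_cos_one[of "\<psi> 1 - \<psi> 0"] by linarith
    then obtain k :: int where k: "\<psi> 1 - \<psi> 0 = of_int k * 2 * pi" using cos_one_2pi_int by auto
    have "k \<noteq> 0" using k \<open>\<psi> 1 \<noteq> \<psi> 0\<close> by auto
    then consider "k \<ge> 1" | "k \<le> -1" by linarith
    then show ?thesis
    proof cases
      case 1
      then have "1 * (2 * pi) \<le> real_of_int k * (2 * pi)" by (intro mult_right_mono) auto
      then have "\<psi> 0 + 2 * pi \<le> \<psi> 1" using k by linarith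
      then obtain t where t: "0 \<le> t" "t \<le> 1" "\<psi> t = \<psi> 0 + 2 * pi"
        using IVT'[of \<psi> 0 "\<psi> 0 + 2 * pi" 1] \<psi>c by auto
      then have "t \<noteq> 0" by auto
      moreover have "\<gamma> t = \<gamma> 0" using \<gamma>\<psi>[of t] \<gamma>\<psi>[of 0] t by simp
      ultimately have "t = 1" using no_return t by simp
      then show ?thesis using t \<psi>_0 by simp
    next
      case 2
      then have "real_of_int k * (2 * pi) \<le> -1 * (2 * pi)" by (intro mult_right_mono) auto
      then have "\<psi> 1 \<le> \<psi> 0 - 2 * pi" using k by linarith
      then obtain t where t: "0 \<le> t" "t \<le> 1" "\<psi> t = \<psi> 0 - 2 * pi"
        using IVT2'[of \<psi> 1 "\<psi> 0 - 2 * pi" 0] \<psi>c by auto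
      then have "t \<noteq> 0" by auto
      moreover have "\<gamma> t = \<gamma> 0"
        using \<gamma>\<psi>[of t] \<gamma>\<psi>[of 0] t support_point_add_2pi[of "\<psi> 0 - 2 * pi"] by simp
      ultimately have "t = 1" using no_return t by simp
      then show ?thesis using t \<psi>_0 by simp
    qed
  qed
  have "compact (\<psi> ` {0..1})" by (intro compact_continuous_image \<psi>c) simp
  then obtain c where c: "\<And>x. x \<in> \<psi> ` {0..1} \<Longrightarrow> \<bar>x\<bar> \<le> c"
    using compact_imp_bounded by (force simp: bounded_iff)
  have "((\<lambda>t. \<psi>' t *\<^sub>R ?r (\<psi> t)) has_integral (integral {\<psi> 0..\<psi> 1} ?r - integral {\<psi> 1..\<psi> 0} ?r)) {0..1}"
  proof (rule has_integral_substitution_general[of "{}"])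
    show "\<psi> ` {0..1} \<subseteq> {- c..c}"
    proof
      fix x assume "x \<in> \<psi> ` {0..1}"
      from c[OF this] show "x \<in> {- c..c}" by auto
    qed
  qed (use \<psi> in \<open>auto intro!: \<psi>c continuous_intros\<close>)
  then have "J = integral {\<psi> 0..\<psi> 1} ?r - integral {\<psi> 1..\<psi> 0} ?r"
    by (simp add: J_def integral_unique)
  then have "\<bar>J\<bar> = \<bar>integral {0..2*pi} p\<bar>"
    using turn curvature_radius_integral[of \<psi>0] \<psi>0 \<psi>_0 by auto
  then show ?thesis using LJ integral_p_nonneg by simp
qed

end

section \<open>The integral of the powers of the sine of the visual angle\<close>

theorem theorem6p1:
  fixes K :: "(real^2) set" and \<gamma> :: "real \<Rightarrow> real^2" and m :: nat
    and p :: "real \<Rightarrow> real" and L :: real and c_sq :: "nat \<Rightarrow> real" and \<omega> :: "real^2 \<Rightarrow> real"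
  assumes "compact K" and "convex K"
    and "C2_boundary K \<gamma>"
    and "p = support_function K" and "C2_function p"
    and "L = curve_length \<gamma>"
    and "\<And>k. c_sq k = (fourier_cos_coeff p k)^2 + (fourier_sin_coeff p k)^2"
    and "\<And>P. P \<notin> K \<Longrightarrow> \<omega> P = visual_angle \<gamma> P"
    and "m \<ge> 3"
  shows
    "let I = (LINT P:-K|lebesgue. sin (\<omega> P) ^ m);
         A = pi * fact m / (2 ^ (m - 1) * (real m - 2) * (Gamma ((real m + 1) / 2))^2)
               * (L^2 / (2 * pi));
         B = pi^2 * fact m / (2 ^ (m - 1) * (real m - 2));
         T = (\<lambda>k::nat. (-1) ^ (k div 2 + 1) * ((real k)^2 - 1)
               * rGamma ((real m + 1 + real k) / 2) * rGamma ((real m + 1 - real k) / 2) * c_sq k)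
     in set_integrable lebesgue (-K) (\<lambda>P. sin (\<omega> P) ^ m) \<and>
        T summable_on {k. 2 \<le> k \<and> even k} \<and>
        I = A + B * (\<Sum>\<^sub>\<infinity>k\<in>{k. 2 \<le> k \<and> even k}. T k) \<and>
        (odd m \<longrightarrow> I = A + B * (\<Sum>k\<in>{k. 2 \<le> k \<and> k \<le> m - 1 \<and> even k}. T k))"
proof -
  obtain dp ddp where "\<And>x. (p has_vector_derivative dp x) (at x)"
      "\<And>x. (dp has_vector_derivative ddp x) (at x)" and ddp: "continuous_on UNIV ddp"
    using C2_functionE[OF assms(5)] by metis
  then interpret smooth_oval K \<gamma> p dp ddp
    using assms(1-4) by unfold_locales (simp_all add: has_real_derivative_iff_has_vector_derivative)
  note m = assms(9)
  define E where "E = {k::nat. 2 \<le> k \<and> even k}"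
  define A where "A = pi * fact m / (2 ^ (m - 1) * (real m - 2) * (Gamma ((real m + 1) / 2))^2) * (L^2 / (2 * pi))"
  define B where "B = pi^2 * fact m / (2 ^ (m - 1) * (real m - 2))"
  define I where "I = (LINT P:-K|lebesgue. sin (\<omega> P) ^ m)"
  have series: "(\<lambda>k. (-1) ^ (k div 2 + 1) * ((real k)^2 - 1)
      * rGamma ((real m + 1 + real k) / 2) * rGamma ((real m + 1 - real k) / 2) * c_sq k) = visual_series_term m"
    by (simp add: fun_eq_iff visual_series_term_def fourier_power_def assms(7))
  have \<omega>: "sin (\<omega> P) ^ m = sin (visual_angle \<gamma> P) ^ m" if "P \<in> - K" for P
    using assms(8) that by simp
  have "set_integrable lebesgue (- K) (\<lambda>P. sin (\<omega> P) ^ m) = set_integrable lebesgue (- K) (\<lambda>P. sin (visual_angle \<gamma> P) ^ m)"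
    by (rule set_integrable_cong[OF refl refl]) (rule \<omega>)
  then have int: "set_integrable lebesgue (- K) (\<lambda>P. sin (\<omega> P) ^ m)"
    using visual_angle_integral(1)[OF m] by (simp only:)
  have "I = integral (- K) (\<lambda>P. sin (\<omega> P) ^ m)"
    unfolding I_def by (rule set_lebesgue_integral_eq_integral(2)[OF int])
  also have "\<dots> = integral (- K) (\<lambda>P. sin (visual_angle \<gamma> P) ^ m)"
    by (rule integral_cong[OF \<omega>])
  finally have I: "I = integral {0..pi} (\<lambda>\<theta>. integral {0..2*pi} (\<lambda>\<phi>. sin \<theta> ^ (m - 3) * tangent_product \<phi> \<theta>))"
    unfolding visual_angle_integral(2)[OF m] .
  have "L^2 / (2 * pi) = 2 * pi * (fourier_cos_coeff p 0)\<^sup>2"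
    by (simp add: assms(6) curve_length_eq fourier_cos_coeff_def field_simps power2_eq_square)
  then have sum: "visual_series_term m summable_on E" and I_eq: "I = A + B * (\<Sum>\<^sub>\<infinity>k\<in>E. visual_series_term m k)"
    using integral_tangent_product_series[OF m] unfolding I A_def B_def E_def by (simp_all only:)
  have "I = A + B * (\<Sum>k\<in>{k. 2 \<le> k \<and> k \<le> m - 1 \<and> even k}. visual_series_term m k)" if "odd m"
  proof -
    have "(\<Sum>\<^sub>\<infinity>k\<in>E. visual_series_term m k) = (\<Sum>\<^sub>\<infinity>k\<in>{k. 2 \<le> k \<and> k \<le> m - 1 \<and> even k}. visual_series_term m k)"
    proof (rule infsum_cong_neutral)
      fix k assume "k \<in> E - {k. 2 \<le> k \<and> k \<le> m - 1 \<and> even k}"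
      then have "even k" "k > m - 1" by (auto simp: E_def)
      moreover have "k \<noteq> m" using that \<open>even k\<close> by auto
      ultimately show "visual_series_term m k = 0" by (intro visual_series_term_vanishes that) auto
    qed (auto simp: E_def)
    also have "\<dots> = (\<Sum>k\<in>{k. 2 \<le> k \<and> k \<le> m - 1 \<and> even k}. visual_series_term m k)"
      by (rule infsum_finite) (rule finite_subset[of _ "{..m}"], auto)
    finally show ?thesis using I_eq by simp
  qed
  then show ?thesis
    unfolding Let_def series A_def[symmetric] B_def[symmetric] I_def[symmetric] E_def[symmetric]
    using int sum I_eq by blast
qed

end
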